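(* Let $k$ be a field and $Q$ a quiver. Then the following statements hold. (1) Let $i$ be an infinite line point of $Q$ with tail $p$. Then there is an isomorphism of representations of $L_k(Q)$: $L_k(Q)e_i\simeq\mathcal{F}_{[p]}$. (2) Let $i$ be a finite line point of $Q$ with end $i_0$. Then there is an isomorphism of representations of $L_k(Q)$: $L_k(Q)e_i\simeq\mathcal{N}_{i_0}$.
   Context: A quiver $Q=(Q_0,Q_1;s,t)$ consists of a set $Q_0$ of vertices, a set $Q_1$ of arrows and maps $s,t\colon Q_1\to Q_0$ (starting and terminating vertex). A vertex is a sink if no arrow starts at it, an infinite emitter if infinitely many arrows start at it, and regular if it is neither. A finite path of length $n\ge1$ is a sequence $p=\alpha_n\cdots\alpha_2\alpha_1$ of arrows with $t(\alpha_i)=s(\alpha_{i+1})$; $s(p)=s(\alpha_1)$, $t(p)=t(\alpha_n)$; for each vertex $i$ there is a trivial path $e_i$ of length $0$ with $s(e_i)=t(e_i)=i$. Concatenation is written from right to left. An oriented cycle is a nontrivial path $p$ with $s(p)=t(p)$. A vertex $i$ is linear if at most one arrow starts at $i$ and no oriented cycle goes through $i$. A linear vertex $i$ is a line point if every vertex $j$ to which there is a (necessarily unique) path starting from $i$ is linear. A line point $i$ is infinite if there is a left-infinite path $p$ starting at $i$; this unique path is called the tail of $i$. A line point $i$ is finite if there is a sink $i_0$ to which there is a path starting from $i$; this unique sink is called the end of $i$ (a sink is a finite line point whose end is itself). Leavitt path algebra: $L_k(Q)$ is the $k$-algebra (algebras are not required to be unital) given by generators $\{e_i,\alpha,\alpha^*\mid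 i\in Q_0,\alpha\in Q_1\}$ subject to: (0) $e_ie_j=\delta_{ij}e_i$ for $i,j\in Q_0$; (1) $e_{t(\alpha)}\alpha=\alpha=\alpha e_{s(\alpha)}$; (2) $e_{s(\alpha)}\alpha^*=\alpha^*=\alpha^*e_{t(\alpha)}$; (3) $\alpha\beta^*=\delta_{\alpha,\beta}e_{t(\alpha)}$ for $\alpha,\beta\in Q_1$; (4) $\sum_{\{\alpha\in Q_1\mid s(\alpha)=i\}}\alpha^*\alpha=e_i$ for every regular vertex $i$. A representation is a $k$-vector space $M$ with an algebra homomorphism $L_k(Q)\to{\rm End}_k(M)$. The left ideal $L_k(Q)e_i$ is a representation via left multiplication. A left-infinite path is an infinite sequence $p=\cdots\alpha_n\cdots\alpha_2\alpha_1$ of arrows with $t(\alpha_i)=s(\alpha_{i+1})$ for all $i\ge1$; it starts at $s(p)=s(\alpha_1)$; $Q_\infty$ is the set of them. For $n\ge0$, $\tau_{>n}(p)=\cdots\alpha_{n+2}\alpha_{n+1}$. Left-infinite paths $p,q$ are tail-equivalent if $\tau_{>n}(p)=\tau_{>m}(q)$ for some $n,m\ge0$; $[p]$ is the class of $p$. $\mathcal{F}$ is the $k$-vector space with basis $Q_\infty$, with $L_k(Q)$-action, for $p=\cdots\alpha_2\alpha_1$: $e_i.p=\delta_{i,s(p)}p$; $\alpha.p=\delta_{\alpha,\alpha_1}\tau_{>1}(p)$; $\alpha^*.p=p\alpha$ if $t(\alpha)=s(p)$ and $0$ otherwise. $\mathcal{F}_{[p]}$ is the subrepresentation spanned by $\{q\mid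 q\in[p]\}$. $\mathcal{N}$ is the $k$-vector space with basis the finite paths terminating at a sink (trivial paths at sinks included), with action: $e_i.p=\delta_{i,s(p)}p$; $\alpha.p=0$ if $p$ has length $0$, and $\alpha.p=\delta_{\alpha,\alpha_1}\,\alpha_n\cdots\alpha_2$ for $p=\alpha_n\cdots\alpha_2\alpha_1$ (read as $e_{t(\alpha_1)}$ when $n=1$); $\alpha^*.p=p\alpha$ if $t(\alpha)=s(p)$ and $0$ otherwise. For a sink $i$, $\mathcal{N}_i$ is the subrepresentation spanned by the paths $p$ with $t(p)=i$. *)

theory Defs
  imports "Graph_Theory.Arc_Walk" "HOL-Algebra.Module" "HOL-Algebra.QuotRing"
begin

section \<open>Modules, non-unital algebras and their representations\<close>

text \<open>
  Vector spaces are modules over a ring record that is assumed to be a field. The record type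
  \<^type>\<open>module\<close> extends \<^type>\<open>ring\<close>, so it always has a multiplication and a unit; where the
  mathematical object has none, these two record components are \<^const>\<open>undefined\<close> and never used.
\<close>

locale nonunital_algebra = module k A for k (structure) and A (structure) +
  assumes mult_closed: "\<lbrakk>x \<in> carrier A; y \<in> carrier A\<rbrakk> \<Longrightarrow> x \<otimes>\<^bsub>A\<^esub> y \<in> carrier A"
    and mult_assoc: "\<lbrakk>x \<in> carrier A; y \<in> carrier A; z \<in> carrier A\<rbrakk>
      \<Longrightarrow> (x \<otimes>\<^bsub>A\<^esub> y) \<otimes>\<^bsub>A\<^esub> z = x \<otimes>\<^bsub>A\<^esub> (y \<otimes>\<^bsub>A\<^esub> z)"
    and mult_l_distr: "\<lbrakk>x \<in> carrier A; y \<in> carrier A; z \<in> carrier A\<rbrakk>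
      \<Longrightarrow> (x \<oplus>\<^bsub>A\<^esub> y) \<otimes>\<^bsub>A\<^esub> z = x \<otimes>\<^bsub>A\<^esub> z \<oplus>\<^bsub>A\<^esub> y \<otimes>\<^bsub>A\<^esub> z"
    and mult_r_distr: "\<lbrakk>x \<in> carrier A; y \<in> carrier A; z \<in> carrier A\<rbrakk>
      \<Longrightarrow> x \<otimes>\<^bsub>A\<^esub> (y \<oplus>\<^bsub>A\<^esub> z) = x \<otimes>\<^bsub>A\<^esub> y \<oplus>\<^bsub>A\<^esub> x \<otimes>\<^bsub>A\<^esub> z"
    and smult_mult_left: "\<lbrakk>c \<in> carrier k; x \<in> carrier A; y \<in> carrier A\<rbrakk>
      \<Longrightarrow> (c \<odot>\<^bsub>A\<^esub> x) \<otimes>\<^bsub>A\<^esub> y = c \<odot>\<^bsub>A\<^esub> (x \<otimes>\<^bsub>A\<^esub> y)"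
    and smult_mult_right: "\<lbrakk>c \<in> carrier k; x \<in> carrier A; y \<in> carrier A\<rbrakk>
      \<Longrightarrow> x \<otimes>\<^bsub>A\<^esub> (c \<odot>\<^bsub>A\<^esub> y) = c \<odot>\<^bsub>A\<^esub> (x \<otimes>\<^bsub>A\<^esub> y)"

definition linear_maps ::
  "('k, 'r) ring_scheme \<Rightarrow> ('k, 'm, 'x) module_scheme \<Rightarrow> ('k, 'n, 'y) module_scheme \<Rightarrow> ('m \<Rightarrow> 'n) set"
  where "linear_maps k M N = {f \<in> hom (add_monoid M) (add_monoid N).
    \<forall>c \<in> carrier k. \<forall>m \<in> carrier M. f (c \<odot>\<^bsub>M\<^esub> m) = c \<odot>\<^bsub>N\<^esub> f m}"

record ('k, 'm, 'l) rep = "('k, 'm) module" +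
  act :: "'l \<Rightarrow> 'm \<Rightarrow> 'm"

text \<open>The axioms say that \<open>act M\<close> is an algebra homomorphism from \<open>A\<close> to \<open>End\<^sub>k(M)\<close>.\<close>

locale alg_representation = A: nonunital_algebra k A + M: module k M
  for k :: "('k, 'r) ring_scheme" (structure) and A :: "('k, 'l, 'a) module_scheme"
    and M :: "('k, 'm, 'l, 'z) rep_scheme" +
  assumes act_linear: "x \<in> carrier A \<Longrightarrow> act M x \<in> linear_maps k M M"
    and act_add: "\<lbrakk>x \<in> carrier A; y \<in> carrier A; m \<in> carrier M\<rbrakk>
      \<Longrightarrow> act M (x \<oplus>\<^bsub>A\<^esub> y) m = act M x m \<oplus>\<^bsub>M\<^esub> act M y m"
    and act_smult: "\<lbrakk>c \<in> carrier k; x \<in> carrier A; m \<in> carrier M\<rbrakk>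
      \<Longrightarrow> act M (c \<odot>\<^bsub>A\<^esub> x) m = c \<odot>\<^bsub>M\<^esub> act M x m"
    and act_mult: "\<lbrakk>x \<in> carrier A; y \<in> carrier A; m \<in> carrier M\<rbrakk>
      \<Longrightarrow> act M (x \<otimes>\<^bsub>A\<^esub> y) m = act M x (act M y m)"

definition rep_isomorphic ::
  "('k, 'r) ring_scheme \<Rightarrow> ('k, 'l, 'a) module_scheme
    \<Rightarrow> ('k, 'm, 'l, 'x) rep_scheme \<Rightarrow> ('k, 'n, 'l, 'y) rep_scheme \<Rightarrow> bool"
  where "rep_isomorphic k A M N \<longleftrightarrow>
    alg_representation k A M \<and> alg_representation k A N \<and>
    (\<exists>\<phi> \<in> linear_maps k M N. bij_betw \<phi> (carrier M) (carrier N) \<and>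
      (\<forall>x \<in> carrier A. \<forall>m \<in> carrier M. \<phi> (act M x m) = act N x (\<phi> m)))"

definition spanned ::
  "('k, 'r) ring_scheme \<Rightarrow> ('k, 'm, 'x) module_scheme \<Rightarrow> 'm set \<Rightarrow> 'm set"
  where "spanned k M B = \<Inter>{H. submodule H k M \<and> B \<subseteq> H}"

text \<open>The principal left ideal \<open>A e\<close>, acted on by left multiplication.\<close>

definition left_ideal_rep :: "('k, 'l, 'a) module_scheme \<Rightarrow> 'l \<Rightarrow> ('k, 'l, 'l) rep"
  where "left_ideal_rep A e =
    \<lparr>carrier = (\<lambda>x. x \<otimes>\<^bsub>A\<^esub> e) ` carrier A, mult = undefined, one = undefined,
     zero = \<zero>\<^bsub>A\<^esub>, add = (\<oplus>\<^bsub>A\<^esub>), smult = (\<odot>\<^bsub>A\<^esub>), act = (\<otimes>\<^bsub>A\<^esub>)\<rparr>"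


section \<open>Free modules, free non-unital algebras and quotients\<close>

definition free_module :: "('k, 'r) ring_scheme \<Rightarrow> 'x set \<Rightarrow> ('k, 'x \<Rightarrow> 'k) module"
  where "free_module k X =
    \<lparr>carrier = {f. (\<forall>x \<in> X. f x \<in> carrier k) \<and> (\<forall>x. x \<notin> X \<longrightarrow> f x = \<zero>\<^bsub>k\<^esub>)
        \<and> finite {x. f x \<noteq> \<zero>\<^bsub>k\<^esub>}},
     mult = undefined, one = undefined,
     zero = (\<lambda>x. \<zero>\<^bsub>k\<^esub>), add = (\<lambda>f g x. f x \<oplus>\<^bsub>k\<^esub> g x), smult = (\<lambda>c f x. c \<otimes>\<^bsub>k\<^esub> f x)\<rparr>"

definition basis_vec :: "('k, 'r) ring_scheme \<Rightarrow> 'x \<Rightarrow> 'x \<Rightarrow> 'k"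
  where "basis_vec k x = (\<lambda>y. if y = x then \<one>\<^bsub>k\<^esub> else \<zero>\<^bsub>k\<^esub>)"

text \<open>The value at \<open>f\<close> of the linear map into \<open>M\<close> that sends each basis vector \<open>x\<close> to \<open>T x\<close>.\<close>

definition lin_ext ::
  "('k, 'r) ring_scheme \<Rightarrow> ('k, 'm, 'z) module_scheme \<Rightarrow> ('x \<Rightarrow> 'm) \<Rightarrow> ('x \<Rightarrow> 'k) \<Rightarrow> 'm"
  where "lin_ext k M T f = (\<Oplus>\<^bsub>M\<^esub>x \<in> {x. f x \<noteq> \<zero>\<^bsub>k\<^esub>}. f x \<odot>\<^bsub>M\<^esub> T x)"

text \<open>
  The word \<open>[g\<^sub>1, \<dots>, g\<^sub>n]\<close> stands for the product \<open>g\<^sub>1 \<cdots> g\<^sub>n\<close>; the empty word is excluded because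
  the algebra has no unit.
\<close>

definition free_algebra :: "('k, 'r) ring_scheme \<Rightarrow> 'g set \<Rightarrow> ('k, 'g list \<Rightarrow> 'k) module"
  where "free_algebra k S =
    (let A = free_module k {w. w \<noteq> [] \<and> set w \<subseteq> S}
     in A\<lparr>mult := \<lambda>f g. lin_ext k A (\<lambda>u. lin_ext k A (\<lambda>v. basis_vec k (u @ v)) g) f\<rparr>)"

text \<open>
  Without a unit, closure under scalars does not follow from closure under multiplication, so
  algebra ideals are required to be submodules. The locale \<^locale>\<open>ideal\<close> presupposes a unit.
\<close>

definition algebra_ideal ::
  "('k, 'r) ring_scheme \<Rightarrow> ('k, 'l, 'a) module_scheme \<Rightarrow> 'l set \<Rightarrow> bool"
  where "algebra_ideal k A I \<longleftrightarrow> submodule I k A \<and>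
    (\<forall>a \<in> carrier A. \<forall>x \<in> I. a \<otimes>\<^bsub>A\<^esub> x \<in> I \<and> x \<otimes>\<^bsub>A\<^esub> a \<in> I)"

definition gen_algebra_ideal ::
  "('k, 'r) ring_scheme \<Rightarrow> ('k, 'l, 'a) module_scheme \<Rightarrow> 'l set \<Rightarrow> 'l set"
  where "gen_algebra_ideal k A R = \<Inter>{I. algebra_ideal k A I \<and> R \<subseteq> I}"

definition quotient_algebra :: "('k, 'l, 'a) module_scheme \<Rightarrow> 'l set \<Rightarrow> ('k, 'l set) module"
  where "quotient_algebra A I =
    \<lparr>carrier = a_rcosets\<^bsub>A\<^esub> I, mult = rcoset_mult A I, one = undefined, zero = I,
     add = set_add A, smult = (\<lambda>c X. \<Union>x \<in> X. I +>\<^bsub>A\<^esub> (c \<odot>\<^bsub>A\<^esub> x))\<rparr>"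


section \<open>Quivers, line points and left-infinite paths\<close>

text \<open>
  A quiver is a \<^locale>\<open>wf_digraph\<close>, with \<open>s = tail Q\<close> and \<open>t = head Q\<close>. Beware that
  \<^const>\<open>tail\<close> is thus the starting vertex of an arrow and is unrelated to the tail of a line point.
  The path \<open>\<alpha>\<^sub>n \<cdots> \<alpha>\<^sub>1\<close> is the list \<open>[\<alpha>\<^sub>1, \<dots>, \<alpha>\<^sub>n]\<close> in order of traversal, and
  \<open>pre_digraph.awalk Q i p j\<close> says that \<open>p\<close> is a path from \<open>i\<close> to \<open>j\<close>.
\<close>

definition sink :: "('v, 'a) pre_digraph \<Rightarrow> 'v \<Rightarrow> bool"
  where "sink Q i \<longleftrightarrow> i \<in> verts Q \<and> out_arcs Q i = {}"

definition infinite_emitter :: "('v, 'a) pre_digraph \<Rightarrow> 'v \<Rightarrow> bool"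
  where "infinite_emitter Q i \<longleftrightarrow> i \<in> verts Q \<and> infinite (out_arcs Q i)"

definition regular_vertex :: "('v, 'a) pre_digraph \<Rightarrow> 'v \<Rightarrow> bool"
  where "regular_vertex Q i \<longleftrightarrow> i \<in> verts Q \<and> \<not> sink Q i \<and> \<not> infinite_emitter Q i"

definition linear_vertex :: "('v, 'a) pre_digraph \<Rightarrow> 'v \<Rightarrow> bool"
  where "linear_vertex Q i \<longleftrightarrow> i \<in> verts Q \<and>
    (\<forall>\<alpha> \<in> out_arcs Q i. \<forall>\<beta> \<in> out_arcs Q i. \<alpha> = \<beta>) \<and>
    \<not> (\<exists>u p. p \<noteq> [] \<and> pre_digraph.awalk Q u p u \<and> i \<in> set (pre_digraph.awalk_verts Q u p))"

definition line_point :: "('v, 'a) pre_digraph \<Rightarrow> 'v \<Rightarrow> bool"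
  where "line_point Q i \<longleftrightarrow> linear_vertex Q i \<and>
    (\<forall>j p. pre_digraph.awalk Q i p j \<longrightarrow> linear_vertex Q j)"

text \<open>The left-infinite path \<open>\<cdots> \<alpha>\<^sub>2 \<alpha>\<^sub>1\<close> is the sequence \<open>p\<close> with \<open>p n = \<alpha>\<^sub>n\<^sub>+\<^sub>1\<close>.\<close>

definition left_infinite_paths :: "('v, 'a) pre_digraph \<Rightarrow> (nat \<Rightarrow> 'a) set"
  where "left_infinite_paths Q =
    {p. \<forall>n. p n \<in> arcs Q \<and> head Q (p n) = tail Q (p (Suc n))}"

definition inf_start :: "('v, 'a) pre_digraph \<Rightarrow> (nat \<Rightarrow> 'a) \<Rightarrow> 'v"
  where "inf_start Q p = tail Q (p 0)"

definition tau_gt :: "nat \<Rightarrow> (nat \<Rightarrow> 'a) \<Rightarrow> (nat \<Rightarrow> 'a)"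
  where "tau_gt n p = (\<lambda>m. p (n + m))"

definition tail_equivalent :: "(nat \<Rightarrow> 'a) \<Rightarrow> (nat \<Rightarrow> 'a) \<Rightarrow> bool"
  where "tail_equivalent p q \<longleftrightarrow> (\<exists>n m. tau_gt n p = tau_gt m q)"

definition tail_class :: "('v, 'a) pre_digraph \<Rightarrow> (nat \<Rightarrow> 'a) \<Rightarrow> (nat \<Rightarrow> 'a) set"
  where "tail_class Q p = {q \<in> left_infinite_paths Q. tail_equivalent p q}"

text \<open>
  The tail and the end of a line point are unique when they exist, so they are given as relations.
\<close>

definition is_tail_of :: "('v, 'a) pre_digraph \<Rightarrow> 'v \<Rightarrow> (nat \<Rightarrow> 'a) \<Rightarrow> bool"
  where "is_tail_of Q i p \<longleftrightarrow> p \<in> left_infinite_paths Q \<and> inf_start Q p = i"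

definition infinite_line_point :: "('v, 'a) pre_digraph \<Rightarrow> 'v \<Rightarrow> bool"
  where "infinite_line_point Q i \<longleftrightarrow> line_point Q i \<and> (\<exists>p. is_tail_of Q i p)"

definition is_end_of :: "('v, 'a) pre_digraph \<Rightarrow> 'v \<Rightarrow> 'v \<Rightarrow> bool"
  where "is_end_of Q i i0 \<longleftrightarrow> sink Q i0 \<and> (\<exists>p. pre_digraph.awalk Q i p i0)"

definition finite_line_point :: "('v, 'a) pre_digraph \<Rightarrow> 'v \<Rightarrow> bool"
  where "finite_line_point Q i \<longleftrightarrow> line_point Q i \<and> (\<exists>i0. is_end_of Q i i0)"


section \<open>The Leavitt path algebra\<close>

text \<open>\<open>Vertex i\<close>, \<open>Arrow \<alpha>\<close> and \<open>Star \<alpha>\<close> are the generators \<open>e\<^sub>i\<close>, \<open>\<alpha>\<close> and \<open>\<alpha>\<^sup>*\<close>.\<close>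

datatype ('v, 'a) lpa_gen = Vertex 'v | Arrow 'a | Star 'a

definition lpa_gens :: "('v, 'a) pre_digraph \<Rightarrow> ('v, 'a) lpa_gen set"
  where "lpa_gens Q = Vertex ` verts Q \<union> Arrow ` arcs Q \<union> Star ` arcs Q"

definition lpa_free ::
  "('k, 'r) ring_scheme \<Rightarrow> ('v, 'a) pre_digraph \<Rightarrow> ('k, ('v, 'a) lpa_gen list \<Rightarrow> 'k) module"
  where "lpa_free k Q = free_algebra k (lpa_gens Q)"

text \<open>A relation \<open>x = y\<close> is encoded as the element \<open>x - y\<close> of the free algebra.\<close>

definition lpa_relations ::
  "('k, 'r) ring_scheme \<Rightarrow> ('v, 'a) pre_digraph \<Rightarrow> (('v, 'a) lpa_gen list \<Rightarrow> 'k) set"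
  where "lpa_relations k Q =
    (let A = lpa_free k Q; b = basis_vec k in
      {b [Vertex i, Vertex j] \<ominus>\<^bsub>A\<^esub> (if i = j then b [Vertex i] else \<zero>\<^bsub>A\<^esub>)
        | i j. i \<in> verts Q \<and> j \<in> verts Q}
      \<union> {b [Vertex (head Q \<alpha>), Arrow \<alpha>] \<ominus>\<^bsub>A\<^esub> b [Arrow \<alpha>] | \<alpha>. \<alpha> \<in> arcs Q}
      \<union> {b [Arrow \<alpha>, Vertex (tail Q \<alpha>)] \<ominus>\<^bsub>A\<^esub> b [Arrow \<alpha>] | \<alpha>. \<alpha> \<in> arcs Q}
      \<union> {b [Vertex (tail Q \<alpha>), Star \<alpha>] \<ominus>\<^bsub>A\<^esub> b [Star \<alpha>] | \<alpha>. \<alpha> \<in> arcs Q}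
      \<union> {b [Star \<alpha>, Vertex (head Q \<alpha>)] \<ominus>\<^bsub>A\<^esub> b [Star \<alpha>] | \<alpha>. \<alpha> \<in> arcs Q}
      \<union> {b [Arrow \<alpha>, Star \<beta>] \<ominus>\<^bsub>A\<^esub> (if \<alpha> = \<beta> then b [Vertex (head Q \<alpha>)] else \<zero>\<^bsub>A\<^esub>)
        | \<alpha> \<beta>. \<alpha> \<in> arcs Q \<and> \<beta> \<in> arcs Q}
      \<union> {(\<Oplus>\<^bsub>A\<^esub>\<alpha> \<in> out_arcs Q i. b [Star \<alpha>, Arrow \<alpha>]) \<ominus>\<^bsub>A\<^esub> b [Vertex i]
        | i. regular_vertex Q i})"

definition lpa_ideal ::
  "('k, 'r) ring_scheme \<Rightarrow> ('v, 'a) pre_digraph \<Rightarrow> (('v, 'a) lpa_gen list \<Rightarrow> 'k) set"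
  where "lpa_ideal k Q = gen_algebra_ideal k (lpa_free k Q) (lpa_relations k Q)"

definition leavitt ::
  "('k, 'r) ring_scheme \<Rightarrow> ('v, 'a) pre_digraph
    \<Rightarrow> ('k, (('v, 'a) lpa_gen list \<Rightarrow> 'k) set) module"
  where "leavitt k Q = quotient_algebra (lpa_free k Q) (lpa_ideal k Q)"

definition leavitt_gen ::
  "('k, 'r) ring_scheme \<Rightarrow> ('v, 'a) pre_digraph \<Rightarrow> ('v, 'a) lpa_gen
    \<Rightarrow> (('v, 'a) lpa_gen list \<Rightarrow> 'k) set"
  where "leavitt_gen k Q g = lpa_ideal k Q +>\<^bsub>lpa_free k Q\<^esub> basis_vec k [g]"

text \<open>
  The action on the free module with basis \<open>X\<close> determined by prescribing what each generator does to
  each basis vector. A coset acts by the common value of the actions of its representatives.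
  That this value does not depend on the representative, i.e. that the relations act as zero, is not
  built into the definition; it is needed to establish \<^locale>\<open>alg_representation\<close>.
\<close>

definition generated_rep ::
  "('k, 'r) ring_scheme \<Rightarrow> 'x set \<Rightarrow> (('v, 'a) lpa_gen \<Rightarrow> 'x \<Rightarrow> 'x \<Rightarrow> 'k)
    \<Rightarrow> ('k, 'x \<Rightarrow> 'k, (('v, 'a) lpa_gen list \<Rightarrow> 'k) set) rep"
  where "generated_rep k X T =
    (let M = free_module k X;
         word_act = (\<lambda>w m. foldr (\<lambda>g. lin_ext k M (T g)) w m);
         free_act = (\<lambda>x m. lin_ext k M (\<lambda>w. word_act w m) x)
     in module.extend M \<lparr>act = (\<lambda>Y m. the_elem ((\<lambda>x. free_act x m) ` Y))\<rparr>)"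


section \<open>The representations \<open>\<F>\<close> and \<open>\<N>\<close>\<close>

primrec F_gen ::
  "('k, 'r) ring_scheme \<Rightarrow> ('v, 'a) pre_digraph \<Rightarrow> ('v, 'a) lpa_gen
    \<Rightarrow> (nat \<Rightarrow> 'a) \<Rightarrow> (nat \<Rightarrow> 'a) \<Rightarrow> 'k" where
  "F_gen k Q (Vertex i) p = (if i = inf_start Q p then basis_vec k p else (\<lambda>_. \<zero>\<^bsub>k\<^esub>))"
| "F_gen k Q (Arrow \<alpha>) p = (if \<alpha> = p 0 then basis_vec k (tau_gt 1 p) else (\<lambda>_. \<zero>\<^bsub>k\<^esub>))"
| "F_gen k Q (Star \<alpha>) p =
    (if head Q \<alpha> = inf_start Q p then basis_vec k (case_nat \<alpha> p) else (\<lambda>_. \<zero>\<^bsub>k\<^esub>))"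

definition F_rep ::
  "('k, 'r) ring_scheme \<Rightarrow> ('v, 'a) pre_digraph
    \<Rightarrow> ('k, (nat \<Rightarrow> 'a) \<Rightarrow> 'k, (('v, 'a) lpa_gen list \<Rightarrow> 'k) set) rep"
  where "F_rep k Q = generated_rep k (left_infinite_paths Q) (F_gen k Q)"

definition F_class_rep ::
  "('k, 'r) ring_scheme \<Rightarrow> ('v, 'a) pre_digraph \<Rightarrow> (nat \<Rightarrow> 'a)
    \<Rightarrow> ('k, (nat \<Rightarrow> 'a) \<Rightarrow> 'k, (('v, 'a) lpa_gen list \<Rightarrow> 'k) set) rep"
  where "F_class_rep k Q p =
    (F_rep k Q)\<lparr>carrier := spanned k (F_rep k Q) (basis_vec k ` tail_class Q p)\<rparr>"

text \<open>
  In \<open>\<N>\<close> a finite path is paired with its starting vertex, so that the trivial paths are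
  distinguished: \<open>(i, [])\<close> is \<open>e\<^sub>i\<close>.
\<close>

definition paths_to :: "('v, 'a) pre_digraph \<Rightarrow> 'v \<Rightarrow> ('v \<times> 'a list) set"
  where "paths_to Q j = {(i, p). pre_digraph.awalk Q i p j}"

fun N_gen ::
  "('k, 'r) ring_scheme \<Rightarrow> ('v, 'a) pre_digraph \<Rightarrow> ('v, 'a) lpa_gen
    \<Rightarrow> 'v \<times> 'a list \<Rightarrow> 'v \<times> 'a list \<Rightarrow> 'k" where
  "N_gen k Q (Vertex i) (j, p) = (if i = j then basis_vec k (j, p) else (\<lambda>_. \<zero>\<^bsub>k\<^esub>))"
| "N_gen k Q (Arrow \<alpha>) (j, []) = (\<lambda>_. \<zero>\<^bsub>k\<^esub>)"
| "N_gen k Q (Arrow \<alpha>) (j, \<beta> # p) =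
    (if \<alpha> = \<beta> then basis_vec k (head Q \<beta>, p) else (\<lambda>_. \<zero>\<^bsub>k\<^esub>))"
| "N_gen k Q (Star \<alpha>) (j, p) =
    (if head Q \<alpha> = j then basis_vec k (tail Q \<alpha>, \<alpha> # p) else (\<lambda>_. \<zero>\<^bsub>k\<^esub>))"

definition N_rep ::
  "('k, 'r) ring_scheme \<Rightarrow> ('v, 'a) pre_digraph
    \<Rightarrow> ('k, 'v \<times> 'a list \<Rightarrow> 'k, (('v, 'a) lpa_gen list \<Rightarrow> 'k) set) rep"
  where "N_rep k Q = generated_rep k (\<Union>j \<in> {j. sink Q j}. paths_to Q j) (N_gen k Q)"

definition N_sink_rep ::
  "('k, 'r) ring_scheme \<Rightarrow> ('v, 'a) pre_digraph \<Rightarrow> 'v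
    \<Rightarrow> ('k, 'v \<times> 'a list \<Rightarrow> 'k, (('v, 'a) lpa_gen list \<Rightarrow> 'k) set) rep"
  where "N_sink_rep k Q i =
    (N_rep k Q)\<lparr>carrier := spanned k (N_rep k Q) (basis_vec k ` paths_to Q i)\<rparr>"

end

theory Submission
  imports Defs
begin

text \<open>
  Let \<open>v\<close> be the basis vector of \<open>\<F>\<^bsub>[p]\<^esub>\<close> (resp. \<open>\<N>\<^bsub>i\<^sub>0\<^esub>\<close>) given by the path starting at \<open>i\<close>, and let \<open>\<phi>\<close> be the map
  \<open>x \<mapsto> x.v\<close> on \<open>L e\<^sub>i\<close>. A basis path \<open>y\<close> shares a tail with \<open>v\<close>, say after removing the initial
  segments \<open>q\<close> of \<open>y\<close> and \<open>p\<close> of \<open>v\<close>, and we send it to \<open>q\<^sup>*p e\<^sub>i \<in> L e\<^sub>i\<close>. Since no cycle is reachable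
  from \<open>i\<close>, two such choices of \<open>(p, q)\<close> differ by a common final segment \<open>r\<close>, and \<open>r\<^sup>*r\<close> cancels because
  the vertices on it emit only one arrow; so this is well defined. Comparing the actions of the
  generators, its linear extension \<open>\<psi>\<close> is a homomorphism with \<open>\<psi>(v) = e\<^sub>i\<close>, hence a left inverse of \<open>\<phi>\<close>.
  Finally \<open>\<phi>\<close> is onto since every \<open>y\<close> is reached from \<open>v\<close> by removing and adding arrows.
\<close>

section \<open>Linear maps and free modules\<close>

text \<open>No basis of \<open>L\<close> is at hand, so injectivity of \<phi> cannot be read off
  from elements of \<open>L e_i\<close>. The computation is therefore moved to the side of the
  paths, where a basis is given. The formula for \<psi> is forced: \<open>p\<close> strips
  \<open>v\<close> down to the common tail and \<open>q^*\<close> puts the arrows of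
  \<open>q\<close> back, so \<open>q^* p e_i\<close> sends \<open>v\<close> to \<open>y\<close>, and
  an inverse of \<phi> has to take \<open>y\<close> to it. Relation (4) has two roles. On the path
  spaces it holds because trivial paths occur only at sinks; in \<open>L\<close> it makes
  \<open>r^* r\<close> disappear, provided each vertex on \<open>r\<close> emits exactly one arrow.
  The first role belongs to well-definedness: elements of \<open>L\<close> are cosets, so each
  relation has to act as zero before there is an action. Nothing depends on whether a path is
  infinite, only on its having at most one first arrow and on removing and prepending arrows; hence
  one locale serves \<F> and \<N>. The cases part only in what sharing a tail means:
  tail-equivalence for infinite paths, the same sink for finite ones.\<close>

lemma linear_mapsI:
  assumes "\<And>m. m \<in> carrier M \<Longrightarrow> f m \<in> carrier N"
    and "\<And>m m'. \<lbrakk>m \<in> carrier M; m' \<in> carrier M\<rbrakk> \<Longrightarrow> f (m \<oplus>\<^bsub>M\<^esub> m') = f m \<oplus>\<^bsub>N\<^esub> f m'"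
    and "\<And>c m. \<lbrakk>c \<in> carrier k; m \<in> carrier M\<rbrakk> \<Longrightarrow> f (c \<odot>\<^bsub>M\<^esub> m) = c \<odot>\<^bsub>N\<^esub> f m"
  shows "f \<in> linear_maps k M N"
  using assms by (auto simp: linear_maps_def hom_def)

lemma linear_mapsD:
  assumes "f \<in> linear_maps k M N"
  shows linear_maps_closed: "m \<in> carrier M \<Longrightarrow> f m \<in> carrier N"
    and linear_maps_add:
      "\<lbrakk>m \<in> carrier M; m' \<in> carrier M\<rbrakk> \<Longrightarrow> f (m \<oplus>\<^bsub>M\<^esub> m') = f m \<oplus>\<^bsub>N\<^esub> f m'"
    and linear_maps_smult:
      "\<lbrakk>c \<in> carrier k; m \<in> carrier M\<rbrakk> \<Longrightarrow> f (c \<odot>\<^bsub>M\<^esub> m) = c \<odot>\<^bsub>N\<^esub> f m"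
  using assms by (auto simp: linear_maps_def hom_def)

lemma linear_maps_zero:
  assumes f: "f \<in> linear_maps k M N" and "module k M" "module k N"
  shows "f \<zero>\<^bsub>M\<^esub> = \<zero>\<^bsub>N\<^esub>"
proof -
  interpret M: module k M by fact
  interpret N: module k N by fact
  show ?thesis
    using linear_maps_smult[OF f M.R.zero_closed M.M.zero_closed]
      linear_maps_closed[OF f M.M.zero_closed] by simp
qed

text \<open>The module axioms do not see \<open>mult\<close>, \<open>one\<close> or
  \<open>act\<close>. This moves them between the records built on a free module or on a left ideal,
  which differ only in these fields.\<close>

lemma module_cong:
  assumes "module k M"
    and eq: "carrier N = carrier M" "add N = add M" "zero N = zero M" "smult N = smult M"
  shows "module k N"
proof -
  interpret M: module k M by fact
  show ?thesis
  proof (rule moduleI)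
    show "cring k" by (rule M.R.is_cring)
    show "abelian_group N"
    proof (rule abelian_groupI)
      fix x assume "x \<in> carrier N"
      then show "\<exists>y\<in>carrier N. y \<oplus>\<^bsub>N\<^esub> x = \<zero>\<^bsub>N\<^esub>"
        unfolding eq using M.l_neg M.a_inv_closed by blast
    qed (auto simp: eq M.a_ac)
  qed (auto simp: eq M.smult_l_distr M.smult_r_distr M.smult_assoc1)
qed

lemma free_module_simps [simp]:
  "zero (free_module k X) = (\<lambda>x. \<zero>\<^bsub>k\<^esub>)"
  "add (free_module k X) = (\<lambda>f g x. f x \<oplus>\<^bsub>k\<^esub> g x)"
  "smult (free_module k X) = (\<lambda>c f x. c \<otimes>\<^bsub>k\<^esub> f x)"
  by (simp_all add: free_module_def)

context cring
begin

lemma free_module_carrier_iff: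
  "f \<in> carrier (free_module R X) \<longleftrightarrow>
    (\<forall>x. f x \<in> carrier R) \<and> finite {x. f x \<noteq> \<zero>} \<and> {x. f x \<noteq> \<zero>} \<subseteq> X"
  unfolding free_module_def by (auto simp: subset_iff)

lemma free_module_apply: "f \<in> carrier (free_module R X) \<Longrightarrow> f x \<in> carrier R"
  by (auto simp: free_module_carrier_iff)

lemma basis_vec_carrier: "x \<in> X \<Longrightarrow> basis_vec R x \<in> carrier (free_module R X)"
  unfolding free_module_carrier_iff basis_vec_def by (auto intro: finite_subset[of _ "{x}"])

lemma module_free_module: "module R (free_module R X)"
proof (rule moduleI)
  show "cring R" by (rule is_cring)
  have add: "(\<lambda>x. f x \<oplus> g x) \<in> carrier (free_module R X)"
    if "f \<in> carrier (free_module R X)" "g \<in> carrier (free_module R X)" for f g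
  proof -
    have "{x. f x \<oplus> g x \<noteq> \<zero>} \<subseteq> {x. f x \<noteq> \<zero>} \<union> {x. g x \<noteq> \<zero>}" by auto
    with that show ?thesis
      unfolding free_module_carrier_iff by (auto intro: finite_subset)
  qed
  show smult: "a \<odot>\<^bsub>free_module R X\<^esub> f \<in> carrier (free_module R X)"
    if "a \<in> carrier R" "f \<in> carrier (free_module R X)" for a f
  proof -
    have "{x. a \<otimes> f x \<noteq> \<zero>} \<subseteq> {x. f x \<noteq> \<zero>}" using that(1) by auto
    with that show ?thesis
      unfolding free_module_carrier_iff by (auto intro: finite_subset)
  qed
  show "abelian_group (free_module R X)"
  proof (rule abelian_groupI)
    fix f assume f: "f \<in> carrier (free_module R X)"
    have "(\<ominus> \<one>) \<odot>\<^bsub>free_module R X\<^esub> f \<in> carrier (free_module R X)"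
      using smult[OF _ f] by blast
    moreover have "(\<ominus> \<one>) \<odot>\<^bsub>free_module R X\<^esub> f \<oplus>\<^bsub>free_module R X\<^esub> f = \<zero>\<^bsub>free_module R X\<^esub>"
      using free_module_apply[OF f] by (auto simp: l_minus l_neg)
    ultimately show "\<exists>y\<in>carrier (free_module R X). y \<oplus>\<^bsub>free_module R X\<^esub> f = \<zero>\<^bsub>free_module R X\<^esub>"
      by blast
  qed (auto simp: add free_module_apply a_ac fun_eq_iff, auto simp: free_module_carrier_iff)
qed (auto simp: free_module_apply l_distr r_distr m_assoc fun_eq_iff)

lemma free_module_mono: "X \<subseteq> Y \<Longrightarrow> carrier (free_module R X) \<subseteq> carrier (free_module R Y)"
  unfolding free_module_carrier_iff subset_iff by blast

text \<open>A finitely supported function is a combination of basis vectors. The induction runs over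
  a finite set containing the support, not over the support itself, so the coordinate at
  \<open>a\<close> is split off without asking whether it vanishes.\<close>

lemma free_module_induct [consumes 1, case_names zero basis smult add]:
  assumes f: "f \<in> carrier (free_module R X)"
    and zero: "P (\<lambda>_. \<zero>)"
    and basis: "\<And>x. x \<in> X \<Longrightarrow> P (basis_vec R x)"
    and smult: "\<And>c f. \<lbrakk>c \<in> carrier R; f \<in> carrier (free_module R X); P f\<rbrakk> \<Longrightarrow> P (\<lambda>x. c \<otimes> f x)"
    and add: "\<And>f g. \<lbrakk>f \<in> carrier (free_module R X); g \<in> carrier (free_module R X); P f; P g\<rbrakk>
      \<Longrightarrow> P (\<lambda>x. f x \<oplus> g x)"
  shows "P f"
proof -
  have "P f" if "finite F" "F \<subseteq> X" "{x. f x \<noteq> \<zero>} \<subseteq> F" "\<forall>x. f x \<in> carrier R" for F f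
    using that
  proof (induction F arbitrary: f rule: finite_induct)
    case empty
    then have "f = (\<lambda>_. \<zero>)" by auto
    then show ?case using zero by simp
  next
    case (insert a F)
    let ?g = "f(a := \<zero>)"
    have gF: "{x. ?g x \<noteq> \<zero>} \<subseteq> F" using insert.prems by auto
    have grange: "\<forall>x. ?g x \<in> carrier R" using insert.prems by auto
    have g: "P ?g"
      by (rule insert.IH) (use insert.prems gF grange in auto)
    have gc: "?g \<in> carrier (free_module R X)"
      unfolding free_module_carrier_iff
      using finite_subset[OF gF \<open>finite F\<close>] gF grange insert.prems(1) by blast
    have fa: "f a \<in> carrier R" and a: "a \<in> X" using insert.prems by auto
    have s: "(\<lambda>x. f a \<otimes> basis_vec R a x) \<in> carrier (free_module R X)"
      using module.smult_closed[OF module_free_module fa basis_vec_carrier[OF a]] by simp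
    have "f = (\<lambda>x. f a \<otimes> basis_vec R a x \<oplus> ?g x)"
      using insert.prems(3) by (auto simp: basis_vec_def fun_eq_iff image_subset_iff)
    then show ?case
      using add[OF s gc smult[OF fa basis_vec_carrier[OF a] basis[OF a]] g] by simp
  qed
  from this[of "{x. f x \<noteq> \<zero>}" f] f show ?thesis
    unfolding free_module_carrier_iff by blast
qed

end

text \<open>The supports of \<open>f\<close>, \<open>g\<close> and \<open>f + g\<close> differ, and
  cancellation can shrink the last one; padding with zero summands puts the sums over one index
  set.\<close>

lemma (in module) lin_ext_supset:
  assumes "finite F" "{x. f x \<noteq> \<zero>} \<subseteq> F" "\<forall>x. f x \<in> carrier R" "\<And>x. x \<in> F \<Longrightarrow> T x \<in> carrier M"
  shows "lin_ext R M T f = (\<Oplus>\<^bsub>M\<^esub>x \<in> F. f x \<odot>\<^bsub>M\<^esub> T x)"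
  unfolding lin_ext_def
  by (rule M.add.finprod_mono_neutral_cong) (use assms finite_subset in auto)

lemma (in module) lin_ext_linear:
  assumes T: "\<And>x. x \<in> X \<Longrightarrow> T x \<in> carrier M"
  shows "lin_ext R M T \<in> linear_maps R (free_module R X) M"
proof (rule linear_mapsI)
  fix f assume f: "f \<in> carrier (free_module R X)"
  then show "lin_ext R M T f \<in> carrier M"
    unfolding lin_ext_def R.free_module_carrier_iff
    by (intro M.finsum_closed) (use T in auto)
  {
    fix g assume g: "g \<in> carrier (free_module R X)"
    let ?F = "{x. f x \<noteq> \<zero>} \<union> {x. g x \<noteq> \<zero>}"
    have F: "finite ?F" "?F \<subseteq> X" and r: "\<forall>x. f x \<in> carrier R" "\<forall>x. g x \<in> carrier R"
      using f g by (auto simp: R.free_module_carrier_iff)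
    have TF: "T x \<in> carrier M" if "x \<in> ?F" for x using T F that by blast
    have "lin_ext R M T (\<lambda>x. f x \<oplus> g x) = (\<Oplus>\<^bsub>M\<^esub>x \<in> ?F. (f x \<oplus> g x) \<odot>\<^bsub>M\<^esub> T x)"
      by (rule lin_ext_supset) (use F r TF in auto)
    also have "\<dots> = (\<Oplus>\<^bsub>M\<^esub>x \<in> ?F. f x \<odot>\<^bsub>M\<^esub> T x \<oplus>\<^bsub>M\<^esub> g x \<odot>\<^bsub>M\<^esub> T x)"
      by (rule M.finsum_cong') (use r TF in \<open>auto simp: smult_l_distr\<close>)
    also have "\<dots> = (\<Oplus>\<^bsub>M\<^esub>x \<in> ?F. f x \<odot>\<^bsub>M\<^esub> T x) \<oplus>\<^bsub>M\<^esub> (\<Oplus>\<^bsub>M\<^esub>x \<in> ?F. g x \<odot>\<^bsub>M\<^esub> T x)"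
      by (rule M.finsum_addf) (use r TF in auto)
    also have "\<dots> = lin_ext R M T f \<oplus>\<^bsub>M\<^esub> lin_ext R M T g"
      using lin_ext_supset[of ?F f T] lin_ext_supset[of ?F g T] F r TF by auto
    finally show "lin_ext R M T (f \<oplus>\<^bsub>free_module R X\<^esub> g) = lin_ext R M T f \<oplus>\<^bsub>M\<^esub> lin_ext R M T g"
      by simp
  }
  {
    fix c assume c: "c \<in> carrier R"
    let ?F = "{x. f x \<noteq> \<zero>}"
    have F: "finite ?F" "?F \<subseteq> X" and r: "\<forall>x. f x \<in> carrier R"
      using f by (auto simp: R.free_module_carrier_iff)
    have TF: "T x \<in> carrier M" if "x \<in> ?F" for x using T F that by blast
    have "lin_ext R M T (\<lambda>x. c \<otimes> f x) = (\<Oplus>\<^bsub>M\<^esub>x \<in> ?F. (c \<otimes> f x) \<odot>\<^bsub>M\<^esub> T x)"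
      by (rule lin_ext_supset) (use F r TF c in auto)
    also have "\<dots> = (\<Oplus>\<^bsub>M\<^esub>x \<in> ?F. c \<odot>\<^bsub>M\<^esub> (f x \<odot>\<^bsub>M\<^esub> T x))"
      by (rule M.finsum_cong') (use r TF c in \<open>auto simp: smult_assoc1\<close>)
    also have "\<dots> = c \<odot>\<^bsub>M\<^esub> lin_ext R M T f"
      unfolding lin_ext_def by (rule finsum_smult_ldistr[symmetric]) (use F r TF c in auto)
    finally show "lin_ext R M T (c \<odot>\<^bsub>free_module R X\<^esub> f) = c \<odot>\<^bsub>M\<^esub> lin_ext R M T f"
      by simp
  }
qed

lemma (in module) lin_ext_basis:
  assumes "T x \<in> carrier M"
  shows "lin_ext R M T (basis_vec R x) = T x"
proof -
  have "lin_ext R M T (basis_vec R x) = (\<Oplus>\<^bsub>M\<^esub>y \<in> {x}. basis_vec R x y \<odot>\<^bsub>M\<^esub> T y)"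
    by (rule lin_ext_supset) (use assms in \<open>auto simp: basis_vec_def\<close>)
  also have "\<dots> = T x" using assms by (simp add: basis_vec_def)
  finally show ?thesis .
qed

lemma linear_maps_eqI:
  assumes f: "f \<in> linear_maps k (free_module k X) N" and g: "g \<in> linear_maps k (free_module k X) N"
    and N: "module k N" and eq: "\<And>x. x \<in> X \<Longrightarrow> f (basis_vec k x) = g (basis_vec k x)"
    and v: "v \<in> carrier (free_module k X)"
  shows "f v = g v"
proof -
  interpret N: module k N by fact
  note F = N.R.module_free_module[of X]
  note simps = linear_maps_add[where M = "free_module k X", simplified]
    linear_maps_smult[where M = "free_module k X", simplified]
  show ?thesis
    using v
  proof (induction rule: N.R.free_module_induct)
    case zero
    show ?case
      using linear_maps_zero[OF f F N] linear_maps_zero[OF g F N] by simp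
  next
    case (basis x) then show ?case by (rule eq)
  next
    case (smult c h) then show ?case by (simp add: simps[OF f] simps[OF g])
  next
    case (add h h') then show ?case by (simp add: simps[OF f] simps[OF g])
  qed
qed

text \<open>Linearity in the first argument carries linearity in the second from basis vectors to
  their combinations. It serves the product of the free algebra and its action on vectors, where the
  outer \<open>lin_ext\<close> shows linearity in one argument only.\<close>

lemma linear_maps_bilinear:
  assumes N: "module k N" and P: "module k P"
    and left: "\<And>g. g \<in> carrier N \<Longrightarrow> (\<lambda>f. B f g) \<in> linear_maps k (free_module k X) P"
    and right: "\<And>x. x \<in> X \<Longrightarrow> B (basis_vec k x) \<in> linear_maps k N P"
    and f: "f \<in> carrier (free_module k X)"
  shows "B f \<in> linear_maps k N P"
proof -
  interpret N: module k N by fact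
  interpret P: module k P by fact
  note F = N.R.module_free_module[of X]
  note B_add = linear_maps_add[OF left, simplified] and B_smult = linear_maps_smult[OF left, simplified]
  show ?thesis
    using f
  proof (induction rule: N.R.free_module_induct)
    case zero
    then show ?case
      using linear_maps_zero[OF left F P] by (intro linear_mapsI) simp_all
  next
    case (basis x)
    then show ?case by (rule right)
  next
    case (smult c f)
    note D = linear_mapsD[OF smult.IH]
    show ?case
    proof (rule linear_mapsI)
      fix d m assume d: "d \<in> carrier k" and m: "m \<in> carrier N"
      \<comment> \<open>Commutativity of \<open>k\<close> lets the two scalars change
        places.\<close>
      have "c \<odot>\<^bsub>P\<^esub> (d \<odot>\<^bsub>P\<^esub> B f m) = d \<odot>\<^bsub>P\<^esub> (c \<odot>\<^bsub>P\<^esub> B f m)"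
        using smult.hyps(1) d D(1)[OF m] by (simp add: P.smult_assoc1[symmetric] N.R.m_comm)
      then show "B (\<lambda>x. c \<otimes>\<^bsub>k\<^esub> f x) (d \<odot>\<^bsub>N\<^esub> m) = d \<odot>\<^bsub>P\<^esub> B (\<lambda>x. c \<otimes>\<^bsub>k\<^esub> f x) m"
        using smult.hyps d m by (simp add: B_smult D)
    qed (use smult.hyps in \<open>simp_all add: B_smult D P.smult_r_distr\<close>)
  next
    case (add f g)
    note D = linear_mapsD[OF add.IH(1)] linear_mapsD[OF add.IH(2)]
    show ?case
      by (rule linear_mapsI) (use add.hyps in \<open>simp_all add: B_add D P.smult_r_distr P.M.a_ac\<close>)
  qed
qed

lemma linear_maps_comp:
  "\<lbrakk>f \<in> linear_maps k M N; g \<in> linear_maps k N P\<rbrakk> \<Longrightarrow> (\<lambda>x. g (f x)) \<in> linear_maps k M P"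
  by (rule linear_mapsI) (simp_all add: linear_mapsD)

section \<open>Submodules and spans of basis vectors\<close>

lemma (in module) submodule_mem:
  assumes "submodule H R M"
  shows submodule_zero: "\<zero>\<^bsub>M\<^esub> \<in> H"
    and submodule_add: "\<lbrakk>x \<in> H; y \<in> H\<rbrakk> \<Longrightarrow> x \<oplus>\<^bsub>M\<^esub> y \<in> H"
    and submodule_smult: "\<lbrakk>c \<in> carrier R; x \<in> H\<rbrakk> \<Longrightarrow> c \<odot>\<^bsub>M\<^esub> x \<in> H"
    and submodule_carrier: "x \<in> H \<Longrightarrow> x \<in> carrier M"
  using subgroup.one_closed[OF submodule.axioms(1)[OF assms]] submoduleE[OF assms] by auto

text \<open>Negation is multiplication by \<open>- 1\<close>, so closure under scalars takes care of
  it.\<close>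

lemma (in module) submoduleI':
  assumes "H \<subseteq> carrier M" "\<zero>\<^bsub>M\<^esub> \<in> H"
    and "\<And>x y. \<lbrakk>x \<in> H; y \<in> H\<rbrakk> \<Longrightarrow> x \<oplus>\<^bsub>M\<^esub> y \<in> H"
    and "\<And>c x. \<lbrakk>c \<in> carrier R; x \<in> H\<rbrakk> \<Longrightarrow> c \<odot>\<^bsub>M\<^esub> x \<in> H"
  shows "submodule H R M"
proof (rule submoduleI)
  fix a assume a: "a \<in> H"
  then have "\<ominus>\<^bsub>M\<^esub> a = (\<ominus> \<one>) \<odot>\<^bsub>M\<^esub> a"
    using assms(1) by (auto simp: smult_l_minus)
  then show "\<ominus>\<^bsub>M\<^esub> a \<in> H" using assms(4)[OF _ a] by simp
qed (use assms in auto)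

text \<open>\<open>M\<close> shares only four fields with the free module because it will be a
  \<open>generated_rep\<close>, which carries an action besides. The spans in
  \<open>F_class_rep\<close> and \<open>N_sink_rep\<close> thereby become free modules on sets of
  paths, and linear maps on them can be given on basis vectors.\<close>

lemma
  assumes "module k M" "Y \<subseteq> X"
    and eq: "carrier M = carrier (free_module k X)" "add M = add (free_module k X)"
      "zero M = zero (free_module k X)" "smult M = smult (free_module k X)"
  shows submodule_free_module: "submodule (carrier (free_module k Y)) k M"
    and spanned_basis_vec: "spanned k M (basis_vec k ` Y) = carrier (free_module k Y)"
proof -
  interpret M: module k M by fact
  interpret Y: module k "free_module k Y" by (rule M.R.module_free_module)
  show sub: "submodule (carrier (free_module k Y)) k M"
  proof (rule M.submoduleI')
    show "carrier (free_module k Y) \<subseteq> carrier M"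
      unfolding eq by (rule M.R.free_module_mono[OF assms(2)])
    show "\<zero>\<^bsub>M\<^esub> \<in> carrier (free_module k Y)"
      using Y.M.zero_closed by (simp add: eq(3))
  next
    fix x y assume "x \<in> carrier (free_module k Y)" "y \<in> carrier (free_module k Y)"
    from Y.M.a_closed[OF this] show "x \<oplus>\<^bsub>M\<^esub> y \<in> carrier (free_module k Y)"
      by (simp add: eq(2))
  next
    fix c x assume "c \<in> carrier k" "x \<in> carrier (free_module k Y)"
    from Y.smult_closed[OF this] show "c \<odot>\<^bsub>M\<^esub> x \<in> carrier (free_module k Y)"
      by (simp add: eq(4))
  qed
  from sub have "spanned k M (basis_vec k ` Y) \<subseteq> carrier (free_module k Y)"
    unfolding spanned_def by (intro Inter_lower) (simp add: M.R.basis_vec_carrier image_subset_iff)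
  moreover have "f \<in> H"
    if "f \<in> carrier (free_module k Y)" and H: "submodule H k M" "basis_vec k ` Y \<subseteq> H" for f H
    using that(1)
  proof (induction rule: M.R.free_module_induct)
    case zero then show ?case using M.submodule_zero[OF H(1)] by (simp add: eq(3))
  next
    case (basis x) then show ?case using H(2) by blast
  next
    case (smult c f) then show ?case using M.submodule_smult[OF H(1), of c f] by (simp add: eq(4))
  next
    case (add f g) then show ?case using M.submodule_add[OF H(1), of f g] by (simp add: eq(2))
  qed
  ultimately show "spanned k M (basis_vec k ` Y) = carrier (free_module k Y)"
    unfolding spanned_def by blast
qed

section \<open>Free algebras and quotients\<close>

text \<open>Transport of the axioms along a surjection \<pi>. That the operations of
  \<open>B\<close> are compatible with \<pi>, which for cosets means independence of
  representatives, is left to the instance.\<close>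

lemma nonunital_algebra_image:
  assumes "nonunital_algebra k A"
    and \<pi>: "carrier B = \<pi> ` carrier A" "zero B = \<pi> \<zero>\<^bsub>A\<^esub>"
    and add: "\<And>x y. \<lbrakk>x \<in> carrier A; y \<in> carrier A\<rbrakk> \<Longrightarrow> \<pi> x \<oplus>\<^bsub>B\<^esub> \<pi> y = \<pi> (x \<oplus>\<^bsub>A\<^esub> y)"
    and mult: "\<And>x y. \<lbrakk>x \<in> carrier A; y \<in> carrier A\<rbrakk> \<Longrightarrow> \<pi> x \<otimes>\<^bsub>B\<^esub> \<pi> y = \<pi> (x \<otimes>\<^bsub>A\<^esub> y)"
    and smult: "\<And>c x. \<lbrakk>c \<in> carrier k; x \<in> carrier A\<rbrakk> \<Longrightarrow> c \<odot>\<^bsub>B\<^esub> \<pi> x = \<pi> (c \<odot>\<^bsub>A\<^esub> x)"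
  shows "nonunital_algebra k B"
proof -
  interpret A: nonunital_algebra k A by fact
  show ?thesis
  proof (intro nonunital_algebra.intro nonunital_algebra_axioms.intro moduleI)
    show "cring k" by (rule A.R.is_cring)
    show "abelian_group B"
    proof (rule abelian_groupI)
      fix x assume "x \<in> carrier B"
      then obtain a where a: "a \<in> carrier A" "x = \<pi> a" by (auto simp: \<pi>)
      then have "\<pi> (\<ominus>\<^bsub>A\<^esub> a) \<oplus>\<^bsub>B\<^esub> x = \<zero>\<^bsub>B\<^esub>"
        by (simp add: add \<pi> A.l_neg)
      then show "\<exists>y\<in>carrier B. y \<oplus>\<^bsub>B\<^esub> x = \<zero>\<^bsub>B\<^esub>"
        using a by (auto simp: \<pi>)
    qed (auto simp: \<pi> add A.a_ac)
  qed (auto simp: \<pi> add smult mult A.mult_closed A.mult_assoc A.mult_l_distr A.mult_r_distr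
      A.smult_mult_left A.smult_mult_right A.smult_l_distr A.smult_r_distr A.smult_assoc1)
qed

section \<open>The free algebra on nonempty words\<close>

abbreviation words :: "'g set \<Rightarrow> 'g list set"
  where "words S \<equiv> {w. w \<noteq> [] \<and> set w \<subseteq> S}"

lemma free_algebra_simps [simp]:
  "carrier (free_algebra k S) = carrier (free_module k (words S))"
  "zero (free_algebra k S) = (\<lambda>x. \<zero>\<^bsub>k\<^esub>)"
  "add (free_algebra k S) = (\<lambda>f g x. f x \<oplus>\<^bsub>k\<^esub> g x)"
  "smult (free_algebra k S) = (\<lambda>c f x. c \<otimes>\<^bsub>k\<^esub> f x)"
  by (simp_all add: free_algebra_def Let_def free_module_def)

lemma free_algebra_mult:
  "mult (free_algebra k S) = (\<lambda>f g. lin_ext k (free_module k (words S))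
    (\<lambda>u. lin_ext k (free_module k (words S)) (\<lambda>v. basis_vec k (u @ v)) g) f)"
  by (simp add: free_algebra_def Let_def)

context cring
begin

lemma lin_ext_append_linear:
  assumes "u \<in> words S"
  shows "lin_ext R (free_module R (words S)) (\<lambda>v. basis_vec R (u @ v))
    \<in> linear_maps R (free_module R (words S)) (free_module R (words S))"
  by (rule module.lin_ext_linear[OF module_free_module], rule basis_vec_carrier) (use assms in auto)

lemma free_algebra_mult_linear_left:
  assumes "g \<in> carrier (free_module R (words S))"
  shows "(\<lambda>f. f \<otimes>\<^bsub>free_algebra R S\<^esub> g)
    \<in> linear_maps R (free_module R (words S)) (free_module R (words S))"
  unfolding free_algebra_mult
  by (rule module.lin_ext_linear[OF module_free_module])
    (rule linear_maps_closed[OF lin_ext_append_linear assms])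

lemma free_algebra_mult_basis_left:
  assumes "g \<in> carrier (free_module R (words S))" "u \<in> words S"
  shows "basis_vec R u \<otimes>\<^bsub>free_algebra R S\<^esub> g
    = lin_ext R (free_module R (words S)) (\<lambda>v. basis_vec R (u @ v)) g"
  unfolding free_algebra_mult
  by (rule module.lin_ext_basis[OF module_free_module])
    (rule linear_maps_closed[OF lin_ext_append_linear], use assms in auto)

lemma free_algebra_mult_basis:
  assumes "u \<in> words S" "v \<in> words S"
  shows "basis_vec R u \<otimes>\<^bsub>free_algebra R S\<^esub> basis_vec R v = basis_vec R (u @ v)"
  by (subst free_algebra_mult_basis_left, rule basis_vec_carrier)
    (use assms in \<open>auto intro!: module.lin_ext_basis[OF module_free_module] basis_vec_carrier\<close>)

text \<open>The product is a nested \<open>lin_ext\<close> with the first factor outside, so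
  linearity in the second factor is not immediate; when the first factor is a word, only the inner
  \<open>lin_ext\<close> is left.\<close>

lemma free_algebra_mult_linear_right:
  assumes f: "f \<in> carrier (free_module R (words S))"
  shows "(\<lambda>g. f \<otimes>\<^bsub>free_algebra R S\<^esub> g)
    \<in> linear_maps R (free_module R (words S)) (free_module R (words S))"
proof (rule linear_maps_bilinear[OF module_free_module module_free_module
      free_algebra_mult_linear_left _ f])
  let ?F = "free_module R (words S)"
  fix u assume u: "u \<in> words S"
  note lin = lin_ext_append_linear[OF u]
  show "(\<lambda>g. basis_vec R u \<otimes>\<^bsub>free_algebra R S\<^esub> g) \<in> linear_maps R ?F ?F"
    by (rule linear_mapsI)
      (simp_all only: free_algebra_mult_basis_left[OF _ u] linear_mapsD[OF lin]
        module.smult_closed[OF module_free_module]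
        abelian_monoid.a_closed[OF abelian_group.axioms(1)[OF module.axioms(2)[OF module_free_module]]])
qed

text \<open>Linearity in each of the three factors reduces associativity to words, where it is
  associativity of \<open>@\<close>.\<close>

lemma nonunital_algebra_free_algebra: "nonunital_algebra R (free_algebra R S)"
proof -
  let ?F = "free_module R (words S)"
  note left = free_algebra_mult_linear_left[where S = S]
    and right = free_algebra_mult_linear_right[where S = S]
  note cl = linear_maps_closed[OF left]
  have assoc: "(x \<otimes>\<^bsub>free_algebra R S\<^esub> y) \<otimes>\<^bsub>free_algebra R S\<^esub> z
      = x \<otimes>\<^bsub>free_algebra R S\<^esub> (y \<otimes>\<^bsub>free_algebra R S\<^esub> z)"
    if x: "x \<in> carrier ?F" and y: "y \<in> carrier ?F" and z: "z \<in> carrier ?F" for x y z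
  proof (rule linear_maps_eqI[OF linear_maps_comp[OF left left] left module_free_module _ x])
    fix u assume u: "u \<in> words S"
    note bu = basis_vec_carrier[OF u]
    show "(basis_vec R u \<otimes>\<^bsub>free_algebra R S\<^esub> y) \<otimes>\<^bsub>free_algebra R S\<^esub> z
      = basis_vec R u \<otimes>\<^bsub>free_algebra R S\<^esub> (y \<otimes>\<^bsub>free_algebra R S\<^esub> z)"
    proof (rule linear_maps_eqI[OF linear_maps_comp[OF right left] linear_maps_comp[OF left right] module_free_module _ y])
      fix v assume v: "v \<in> words S"
      note bv = basis_vec_carrier[OF v]
      show "(basis_vec R u \<otimes>\<^bsub>free_algebra R S\<^esub> basis_vec R v) \<otimes>\<^bsub>free_algebra R S\<^esub> z
        = basis_vec R u \<otimes>\<^bsub>free_algebra R S\<^esub> (basis_vec R v \<otimes>\<^bsub>free_algebra R S\<^esub> z)"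
      proof (rule linear_maps_eqI[OF right linear_maps_comp[OF right right] module_free_module _ z])
        fix w assume w: "w \<in> words S"
        have uv: "u @ v \<in> words S" and vw: "v @ w \<in> words S" using u v w by auto
        show "(basis_vec R u \<otimes>\<^bsub>free_algebra R S\<^esub> basis_vec R v) \<otimes>\<^bsub>free_algebra R S\<^esub> basis_vec R w
          = basis_vec R u \<otimes>\<^bsub>free_algebra R S\<^esub> (basis_vec R v \<otimes>\<^bsub>free_algebra R S\<^esub> basis_vec R w)"
          unfolding free_algebra_mult_basis[OF u v] free_algebra_mult_basis[OF v w]
            free_algebra_mult_basis[OF uv w] free_algebra_mult_basis[OF u vw] by simp
      qed (intro cl bu bv)+
    qed (intro cl z bu)+
  qed (intro cl y z)+
  have M: "module R (free_algebra R S)"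
    by (rule module_cong[OF module_free_module]) simp_all
  show ?thesis
  proof (intro nonunital_algebra.intro nonunital_algebra_axioms.intro)
    show "module R (free_algebra R S)" by (rule M)
  qed (use cl assoc linear_maps_add[OF left] linear_maps_smult[OF left]
        linear_maps_add[OF right] linear_maps_smult[OF right] in simp_all)
qed

end

context nonunital_algebra
begin

lemma mult_zero_left: "x \<in> carrier A \<Longrightarrow> \<zero>\<^bsub>A\<^esub> \<otimes>\<^bsub>A\<^esub> x = \<zero>\<^bsub>A\<^esub>"
  using smult_mult_left[of \<zero> "\<zero>\<^bsub>A\<^esub>" x] mult_closed[of "\<zero>\<^bsub>A\<^esub>" x] by simp

lemma mult_zero_right: "x \<in> carrier A \<Longrightarrow> x \<otimes>\<^bsub>A\<^esub> \<zero>\<^bsub>A\<^esub> = \<zero>\<^bsub>A\<^esub>"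
  using smult_mult_right[of \<zero> x "\<zero>\<^bsub>A\<^esub>"] mult_closed[of x "\<zero>\<^bsub>A\<^esub>"] by simp

lemma algebra_ideal_gen_algebra_ideal:
  assumes "X \<subseteq> carrier A"
  shows "algebra_ideal k A (gen_algebra_ideal k A X)"
proof -
  let ?I = "gen_algebra_ideal k A X"
  \<comment> \<open>The whole algebra is an ideal containing \<open>X\<close>, so the intersection
    has a nonempty index family and stays inside the carrier.\<close>
  have "algebra_ideal k A (carrier A)"
    unfolding algebra_ideal_def using carrier_is_submodule mult_closed by blast
  then have "?I \<subseteq> carrier A" unfolding gen_algebra_ideal_def using assms by blast
  then have "submodule ?I k A"
  proof (rule submoduleI')
    show "\<zero>\<^bsub>A\<^esub> \<in> ?I"
      unfolding gen_algebra_ideal_def algebra_ideal_def using submodule_zero by blast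
  next
    fix x y assume "x \<in> ?I" "y \<in> ?I"
    then show "x \<oplus>\<^bsub>A\<^esub> y \<in> ?I"
      unfolding gen_algebra_ideal_def algebra_ideal_def using submodule_add by blast
  next
    fix c x assume "c \<in> carrier k" "x \<in> ?I"
    then show "c \<odot>\<^bsub>A\<^esub> x \<in> ?I"
      unfolding gen_algebra_ideal_def algebra_ideal_def using submodule_smult by blast
  qed
  then show ?thesis
    unfolding algebra_ideal_def by (auto simp: gen_algebra_ideal_def algebra_ideal_def)
qed

lemma gen_algebra_ideal_incl: "X \<subseteq> gen_algebra_ideal k A X"
  unfolding gen_algebra_ideal_def by blast

lemma gen_algebra_ideal_least: "\<lbrakk>algebra_ideal k A I; X \<subseteq> I\<rbrakk> \<Longrightarrow> gen_algebra_ideal k A X \<subseteq> I"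
  unfolding gen_algebra_ideal_def by blast

end

section \<open>Quotients by algebra ideals\<close>

locale algebra_quotient = nonunital_algebra +
  fixes I
  assumes ideal: "algebra_ideal k A I"
begin

lemma submodule_ideal: "submodule I k A"
  using ideal unfolding algebra_ideal_def by blast

sublocale abelian_subgroup I A
  by (intro abelian_subgroupI3 additive_subgroup.intro submodule.axioms[OF submodule_ideal])
    (rule M.abelian_group_axioms)

lemma coset_mem_iff:
  assumes "x \<in> carrier A" "a \<in> carrier A"
  shows "a \<in> I +>\<^bsub>A\<^esub> x \<longleftrightarrow> a \<ominus>\<^bsub>A\<^esub> x \<in> I"
  using a_rcos_module[OF assms] by (simp add: a_minus_def)

lemma coset_mem:
  assumes "x \<in> carrier A" "a \<in> I +>\<^bsub>A\<^esub> x"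
  shows "a \<in> carrier A" "a \<ominus>\<^bsub>A\<^esub> x \<in> I"
  using assms coset_mem_iff a_elemrcos_carrier by blast+

lemma coset_eq_iff:
  assumes "x \<in> carrier A" "y \<in> carrier A"
  shows "I +>\<^bsub>A\<^esub> x = I +>\<^bsub>A\<^esub> y \<longleftrightarrow> x \<ominus>\<^bsub>A\<^esub> y \<in> I"
  using coset_mem_iff[OF assms(2,1)] a_rcos_self[OF assms(1)]
    a_repr_independence[OF _ assms(2) a_subgroup] by metis

lemma coset_zero: "I +>\<^bsub>A\<^esub> \<zero>\<^bsub>A\<^esub> = I"
  by (rule M.a_coset_add_zero) (rule a_subset)

lemma quotient_zero: "zero (quotient_algebra A I) = I +>\<^bsub>A\<^esub> \<zero>\<^bsub>A\<^esub>"
  by (simp add: quotient_algebra_def coset_zero)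

lemma quotient_carrier: "carrier (quotient_algebra A I) = (\<lambda>x. I +>\<^bsub>A\<^esub> x) ` carrier A"
  by (auto simp: quotient_algebra_def A_RCOSETS_def')

lemma quotient_add:
  "\<lbrakk>x \<in> carrier A; y \<in> carrier A\<rbrakk>
    \<Longrightarrow> (I +>\<^bsub>A\<^esub> x) \<oplus>\<^bsub>quotient_algebra A I\<^esub> (I +>\<^bsub>A\<^esub> y) = I +>\<^bsub>A\<^esub> (x \<oplus>\<^bsub>A\<^esub> y)"
  by (simp add: quotient_algebra_def a_rcos_sum)

text \<open>A scalar multiple of a coset is defined as a union over its representatives
  \<open>a\<close>; the united cosets coincide because \<open>c a - c x = c (a - x)\<close> lies in
  \<open>I\<close>.\<close>

lemma quotient_smult:
  assumes c: "c \<in> carrier k" and x: "x \<in> carrier A"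
  shows "c \<odot>\<^bsub>quotient_algebra A I\<^esub> (I +>\<^bsub>A\<^esub> x) = I +>\<^bsub>A\<^esub> (c \<odot>\<^bsub>A\<^esub> x)"
proof -
  have "I +>\<^bsub>A\<^esub> (c \<odot>\<^bsub>A\<^esub> a) = I +>\<^bsub>A\<^esub> (c \<odot>\<^bsub>A\<^esub> x)" if "a \<in> I +>\<^bsub>A\<^esub> x" for a
  proof -
    note a = coset_mem[OF x that]
    have "c \<odot>\<^bsub>A\<^esub> a \<ominus>\<^bsub>A\<^esub> c \<odot>\<^bsub>A\<^esub> x = c \<odot>\<^bsub>A\<^esub> (a \<ominus>\<^bsub>A\<^esub> x)"
      using a x c by (simp add: a_minus_def smult_r_distr smult_r_minus)
    then show ?thesis
      using a x c submodule_smult[OF submodule_ideal] by (simp add: coset_eq_iff)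
  qed
  then show ?thesis
    unfolding quotient_algebra_def module.simps
    using a_rcos_self[OF x] by (intro SUP_eq_const) blast+
qed

text \<open>The product of cosets is a union over all pairs of representatives; it collapses to one
  coset because \<open>a b - x y = (a - x) b + x (b - y)\<close> lies in the two-sided ideal
  \<open>I\<close>.\<close>

lemma quotient_mult:
  assumes x: "x \<in> carrier A" and y: "y \<in> carrier A"
  shows "(I +>\<^bsub>A\<^esub> x) \<otimes>\<^bsub>quotient_algebra A I\<^esub> (I +>\<^bsub>A\<^esub> y) = I +>\<^bsub>A\<^esub> (x \<otimes>\<^bsub>A\<^esub> y)"
proof -
  have "I +>\<^bsub>A\<^esub> (a \<otimes>\<^bsub>A\<^esub> b) = I +>\<^bsub>A\<^esub> (x \<otimes>\<^bsub>A\<^esub> y)"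
    if "a \<in> I +>\<^bsub>A\<^esub> x" "b \<in> I +>\<^bsub>A\<^esub> y" for a b
  proof -
    note a = coset_mem[OF x that(1)] and b = coset_mem[OF y that(2)]
    have ab: "a = (a \<ominus>\<^bsub>A\<^esub> x) \<oplus>\<^bsub>A\<^esub> x" "b = (b \<ominus>\<^bsub>A\<^esub> y) \<oplus>\<^bsub>A\<^esub> y"
      using a b x y by (simp_all add: a_minus_def M.a_assoc M.l_neg)
    have "a \<otimes>\<^bsub>A\<^esub> b = (a \<ominus>\<^bsub>A\<^esub> x) \<otimes>\<^bsub>A\<^esub> b \<oplus>\<^bsub>A\<^esub> x \<otimes>\<^bsub>A\<^esub> b"
      using ab(1) a b x mult_l_distr[of "a \<ominus>\<^bsub>A\<^esub> x" x b] by simp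
    also have "x \<otimes>\<^bsub>A\<^esub> b = x \<otimes>\<^bsub>A\<^esub> (b \<ominus>\<^bsub>A\<^esub> y) \<oplus>\<^bsub>A\<^esub> x \<otimes>\<^bsub>A\<^esub> y"
      using ab(2) b x y mult_r_distr[of x "b \<ominus>\<^bsub>A\<^esub> y" y] by simp
    finally have "a \<otimes>\<^bsub>A\<^esub> b \<ominus>\<^bsub>A\<^esub> x \<otimes>\<^bsub>A\<^esub> y
        = (a \<ominus>\<^bsub>A\<^esub> x) \<otimes>\<^bsub>A\<^esub> b \<oplus>\<^bsub>A\<^esub> x \<otimes>\<^bsub>A\<^esub> (b \<ominus>\<^bsub>A\<^esub> y)"
      using a b x y by (simp add: a_minus_def M.a_assoc mult_closed M.r_neg)
    then have "a \<otimes>\<^bsub>A\<^esub> b \<ominus>\<^bsub>A\<^esub> x \<otimes>\<^bsub>A\<^esub> y \<in> I"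
      using ideal a b x submodule_add[OF submodule_ideal] by (simp add: algebra_ideal_def)
    then show ?thesis using a b x y by (simp add: coset_eq_iff mult_closed)
  qed
  then show ?thesis
    unfolding quotient_algebra_def rcoset_mult_def module.simps monoid.simps
    using a_rcos_self[OF x] a_rcos_self[OF y] by (intro SUP_eq_const) blast+
qed

lemma nonunital_algebra_quotient: "nonunital_algebra k (quotient_algebra A I)"
  by (rule nonunital_algebra_image[OF nonunital_algebra_axioms])
    (rule quotient_carrier quotient_zero quotient_add quotient_mult quotient_smult; assumption)+

end

section \<open>Representations on free modules\<close>

text \<open>A name for the local function inside \<open>generated_rep\<close>. With
  \<open>foldr\<close> the last letter of a word acts first, as a left action of the product of the
  letters requires.\<close>

definition free_act ::
  "('k, 'r) ring_scheme \<Rightarrow> 'x set \<Rightarrow> ('g \<Rightarrow> 'x \<Rightarrow> 'x \<Rightarrow> 'k) \<Rightarrow> ('g list \<Rightarrow> 'k) \<Rightarrow> ('x \<Rightarrow> 'k) \<Rightarrow> 'x \<Rightarrow> 'k"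
  where "free_act k X T x m =
    lin_ext k (free_module k X) (\<lambda>w. foldr (\<lambda>g. lin_ext k (free_module k X) (T g)) w m) x"

lemma generated_rep_simps [simp]:
  "carrier (generated_rep k X T) = carrier (free_module k X)"
  "zero (generated_rep k X T) = zero (free_module k X)"
  "add (generated_rep k X T) = add (free_module k X)"
  "smult (generated_rep k X T) = smult (free_module k X)"
  by (simp_all add: generated_rep_def Let_def module.extend_def)

lemma generated_rep_act:
  "act (generated_rep k X T) Y m = the_elem ((\<lambda>x. free_act k X T x m) ` Y)"
  by (simp add: generated_rep_def Let_def module.extend_def free_act_def)

text \<open>No relations are imposed yet: the maps \<open>T g\<close> make the free algebra act, and
  the annihilator of this action decides which quotients act as well.\<close>

locale generators_action = cring R for R (structure) +
  fixes S :: "'g set" and X :: "'x set" and T :: "'g \<Rightarrow> 'x \<Rightarrow> 'x \<Rightarrow> 'a"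
  assumes T_closed: "\<lbrakk>g \<in> S; x \<in> X\<rbrakk> \<Longrightarrow> T g x \<in> carrier (free_module R X)"
begin

abbreviation "FX \<equiv> free_module R X"
abbreviation "FA \<equiv> free_algebra R S"

sublocale FX: module R FX
  by (rule module_free_module)

sublocale FA: nonunital_algebra R FA
  by (rule nonunital_algebra_free_algebra)

lemma gen_linear: "g \<in> S \<Longrightarrow> lin_ext R FX (T g) \<in> linear_maps R FX FX"
  by (rule FX.lin_ext_linear) (rule T_closed)

lemma gen_basis: "\<lbrakk>g \<in> S; x \<in> X\<rbrakk> \<Longrightarrow> lin_ext R FX (T g) (basis_vec R x) = T g x"
  by (rule FX.lin_ext_basis) (rule T_closed)

lemma word_linear:
  "set w \<subseteq> S \<Longrightarrow> foldr (\<lambda>g. lin_ext R FX (T g)) w \<in> linear_maps R FX FX"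
proof (induction w)
  case Nil
  then show ?case by (intro linear_mapsI) simp_all
next
  case (Cons g w)
  then show ?case
    using linear_maps_comp[OF Cons.IH gen_linear[of g]] by (simp add: comp_def)
qed

lemma free_act_linear:
  assumes "m \<in> carrier FX"
  shows "(\<lambda>x. free_act R X T x m) \<in> linear_maps R FA FX"
proof -
  have "(\<lambda>x. free_act R X T x m) \<in> linear_maps R (free_module R (words S)) FX"
    unfolding free_act_def
    by (rule FX.lin_ext_linear) (use linear_maps_closed[OF word_linear assms] in auto)
  then show ?thesis unfolding linear_maps_def by (simp add: hom_def)
qed

text \<open>The free algebra and its underlying free module are different records; this form fits
  the rules that are stated for free modules.\<close>

lemma free_act_linear':
  assumes "m \<in> carrier FX"
  shows "(\<lambda>x. free_act R X T x m) \<in> linear_maps R (free_module R (words S)) FX"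
  using free_act_linear[OF assms] unfolding linear_maps_def by (simp add: hom_def)

lemma free_act_word:
  assumes "w \<in> words S" "m \<in> carrier FX"
  shows "free_act R X T (basis_vec R w) m = foldr (\<lambda>g. lin_ext R FX (T g)) w m"
  unfolding free_act_def
  by (rule FX.lin_ext_basis) (use linear_maps_closed[OF word_linear] assms in auto)

lemma free_act_linear_right:
  assumes "x \<in> carrier FA"
  shows "free_act R X T x \<in> linear_maps R FX FX"
proof (rule linear_maps_bilinear[OF module_free_module module_free_module free_act_linear'])
  show "x \<in> carrier (free_module R (words S))" using assms by simp
next
  fix w assume w: "w \<in> words S"
  then have "set w \<subseteq> S" by simp
  note D = linear_mapsD[OF word_linear[OF this]]
  show "free_act R X T (basis_vec R w) \<in> linear_maps R FX FX"
    by (rule linear_mapsI)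
      (simp_all only: free_act_word[OF w] D FX.M.a_closed FX.smult_closed)
qed

text \<open>Linearity in \<open>x\<close> and \<open>y\<close> leaves two words, for which the claim
  is that \<open>foldr\<close> over \<open>u @ v\<close> is a composition.\<close>

lemma free_act_mult:
  assumes x: "x \<in> carrier FA" and y: "y \<in> carrier FA" and m: "m \<in> carrier FX"
  shows "free_act R X T (x \<otimes>\<^bsub>FA\<^esub> y) m = free_act R X T x (free_act R X T y m)"
proof -
  note lin = free_act_linear'[OF m]
  have x': "x \<in> carrier (free_module R (words S))" and y': "y \<in> carrier (free_module R (words S))"
    using x y by simp_all
  have ym: "free_act R X T y m \<in> carrier FX" by (rule linear_maps_closed[OF lin y'])
  show ?thesis
  proof (rule linear_maps_eqI[OF linear_maps_comp[OF free_algebra_mult_linear_left[OF y'] lin]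
        free_act_linear'[OF ym] module_free_module _ x'])
    fix u assume u: "u \<in> words S"
    then have bu: "basis_vec R u \<in> carrier FA" by (simp add: basis_vec_carrier)
    show "free_act R X T (basis_vec R u \<otimes>\<^bsub>FA\<^esub> y) m = free_act R X T (basis_vec R u) (free_act R X T y m)"
    proof (rule linear_maps_eqI[OF
          linear_maps_comp[OF free_algebra_mult_linear_right[OF basis_vec_carrier[OF u]] lin]
          linear_maps_comp[OF lin free_act_linear_right[OF bu]] module_free_module _ y'])
      fix v assume v: "v \<in> words S"
      have uv: "u @ v \<in> words S" using u v by simp
      show "free_act R X T (basis_vec R u \<otimes>\<^bsub>FA\<^esub> basis_vec R v) m
        = free_act R X T (basis_vec R u) (free_act R X T (basis_vec R v) m)"
        unfolding free_algebra_mult_basis[OF u v] free_act_word[OF uv m] free_act_word[OF v m]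
        using free_act_word[OF u, of "foldr (\<lambda>g. lin_ext R FX (T g)) v m"]
          linear_maps_closed[OF word_linear m] v by simp
    qed
  qed
qed

text \<open>Testing on basis vectors is what can be carried out for concrete relations; by linearity
  such elements kill every vector.\<close>

definition annihilator :: "('g list \<Rightarrow> 'a) set"
  where "annihilator = {x \<in> carrier FA. \<forall>x' \<in> X. free_act R X T x (basis_vec R x') = \<zero>\<^bsub>FX\<^esub>}"

lemma zero_linear: "(\<lambda>_. \<zero>\<^bsub>FX\<^esub>) \<in> linear_maps R FX FX"
  by (rule linear_mapsI) (use FX.M.zero_closed in simp_all)

lemma annihilator_act:
  assumes "x \<in> annihilator" "m \<in> carrier FX"
  shows "free_act R X T x m = \<zero>\<^bsub>FX\<^esub>"
  by (rule linear_maps_eqI[OF free_act_linear_right zero_linear module_free_module _ assms(2)])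
    (use assms(1) in \<open>auto simp: annihilator_def\<close>)

text \<open>For closure under \<open>x a\<close> it matters that \<open>x\<close> kills all vectors,
  since \<open>a\<close> may send a basis vector anywhere.\<close>

lemma annihilator_ideal: "algebra_ideal R FA annihilator"
proof -
  have bv: "basis_vec R x \<in> carrier FX" if "x \<in> X" for x by (rule basis_vec_carrier[OF that])
  have "submodule annihilator R FA"
  proof (rule FA.submoduleI')
    show "annihilator \<subseteq> carrier FA" unfolding annihilator_def by blast
    show "\<zero>\<^bsub>FA\<^esub> \<in> annihilator"
      using linear_maps_zero[OF free_act_linear[OF bv] FA.module_axioms FX.module_axioms] FA.M.zero_closed
      unfolding annihilator_def by blast
  next
    fix x y assume "x \<in> annihilator" "y \<in> annihilator"
    then show "x \<oplus>\<^bsub>FA\<^esub> y \<in> annihilator"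
      using linear_maps_add[OF free_act_linear[OF bv], of _ x y] FA.M.a_closed[of x y]
        FX.M.l_zero[OF FX.M.zero_closed]
      unfolding annihilator_def mem_Collect_eq by metis
  next
    fix c x assume "c \<in> carrier R" "x \<in> annihilator"
    then show "c \<odot>\<^bsub>FA\<^esub> x \<in> annihilator"
      using linear_maps_smult[OF free_act_linear[OF bv], of _ c x] FA.smult_closed[of c x]
        FX.smult_r_null[of c]
      unfolding annihilator_def mem_Collect_eq by metis
  qed
  moreover have "a \<otimes>\<^bsub>FA\<^esub> x \<in> annihilator \<and> x \<otimes>\<^bsub>FA\<^esub> a \<in> annihilator"
    if a: "a \<in> carrier FA" and x: "x \<in> annihilator" for a x
  proof -
    have xc: "x \<in> carrier FA" using x unfolding annihilator_def by blast
    have "free_act R X T (a \<otimes>\<^bsub>FA\<^esub> x) (basis_vec R y) = \<zero>\<^bsub>FX\<^esub>" if "y \<in> X" for y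
      unfolding free_act_mult[OF a xc bv[OF that]] annihilator_act[OF x bv[OF that]]
      by (rule linear_maps_zero[OF free_act_linear_right[OF a] FX.module_axioms FX.module_axioms])
    moreover have "free_act R X T (x \<otimes>\<^bsub>FA\<^esub> a) (basis_vec R y) = \<zero>\<^bsub>FX\<^esub>" if "y \<in> X" for y
      unfolding free_act_mult[OF xc a bv[OF that]]
      by (rule annihilator_act[OF x linear_maps_closed[OF free_act_linear_right[OF a] bv[OF that]]])
    ultimately show ?thesis
      unfolding annihilator_def using FA.mult_closed[OF a xc] FA.mult_closed[OF xc a] by blast
  qed
  ultimately show ?thesis unfolding algebra_ideal_def by blast
qed

end

text \<open>Every coset is a combination of classes of words, and a word is a product of its
  letters. There is no empty word, so words are built up from single letters.\<close>

lemma free_algebra_quotient_induct [consumes 2, case_names zero gen add smult mult]: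
  assumes "algebra_quotient k (free_algebra k S) I"
    and x: "x \<in> carrier (quotient_algebra (free_algebra k S) I)"
    and zero: "P \<zero>\<^bsub>quotient_algebra (free_algebra k S) I\<^esub>"
    and gen: "\<And>g. g \<in> S \<Longrightarrow> P (I +>\<^bsub>free_algebra k S\<^esub> basis_vec k [g])"
    and add: "\<And>x y. \<lbrakk>x \<in> carrier (quotient_algebra (free_algebra k S) I);
      y \<in> carrier (quotient_algebra (free_algebra k S) I); P x; P y\<rbrakk>
      \<Longrightarrow> P (x \<oplus>\<^bsub>quotient_algebra (free_algebra k S) I\<^esub> y)"
    and smult: "\<And>c x. \<lbrakk>c \<in> carrier k; x \<in> carrier (quotient_algebra (free_algebra k S) I); P x\<rbrakk>
      \<Longrightarrow> P (c \<odot>\<^bsub>quotient_algebra (free_algebra k S) I\<^esub> x)"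
    and mult: "\<And>x y. \<lbrakk>x \<in> carrier (quotient_algebra (free_algebra k S) I);
      y \<in> carrier (quotient_algebra (free_algebra k S) I); P x; P y\<rbrakk>
      \<Longrightarrow> P (x \<otimes>\<^bsub>quotient_algebra (free_algebra k S) I\<^esub> y)"
  shows "P x"
proof -
  let ?F = "free_algebra k S" and ?Q = "quotient_algebra (free_algebra k S) I"
  interpret Q: algebra_quotient k ?F I by fact
  have word: "P (I +>\<^bsub>?F\<^esub> basis_vec k w)" if "w \<noteq> []" "set w \<subseteq> S" for w
    using that
  proof (induction w rule: list_nonempty_induct)
    case (single g)
    then show ?case using gen by simp
  next
    case (cons g w)
    have g: "[g] \<in> words S" and w: "w \<in> words S" using cons by auto
    have gc: "basis_vec k [g] \<in> carrier ?F" and wc: "basis_vec k w \<in> carrier ?F"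
      using Q.R.basis_vec_carrier[OF g] Q.R.basis_vec_carrier[OF w] by simp_all
    have "P ((I +>\<^bsub>?F\<^esub> basis_vec k [g]) \<otimes>\<^bsub>?Q\<^esub> (I +>\<^bsub>?F\<^esub> basis_vec k w))"
      using gc wc g cons by (intro mult gen) (simp_all add: Q.quotient_carrier)
    then show ?case
      unfolding Q.quotient_mult[OF gc wc] Q.R.free_algebra_mult_basis[OF g w] by simp
  qed
  obtain z where z: "z \<in> carrier (free_module k (words S))" and x: "x = I +>\<^bsub>?F\<^esub> z"
    using x by (auto simp: Q.quotient_carrier)
  show ?thesis
    unfolding x using z
  proof (induction rule: Q.R.free_module_induct)
    case zero
    then show ?case using assms(3) by (simp add: Q.quotient_zero)
  next
    case (basis w)
    then show ?case using word by simp
  next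
    case (smult c f)
    then show ?case
      using assms(6)[of c "I +>\<^bsub>?F\<^esub> f"] Q.quotient_smult[of c f] by (simp add: Q.quotient_carrier)
  next
    case (add f g)
    then show ?case
      using assms(5)[of "I +>\<^bsub>?F\<^esub> f" "I +>\<^bsub>?F\<^esub> g"] Q.quotient_add[of f g]
      by (simp add: Q.quotient_carrier)
  qed
qed

locale quotient_action = generators_action R S X T
  for R (structure) and S :: "('v, 'e) lpa_gen set" and X and T +
  fixes I
  assumes I_ideal: "algebra_ideal R (free_algebra R S) I" and I_annihilator: "I \<subseteq> annihilator"
begin

abbreviation "QA \<equiv> quotient_algebra FA I"
abbreviation "GR \<equiv> generated_rep R X T"

sublocale Q: algebra_quotient R FA I
  by (intro algebra_quotient.intro algebra_quotient_axioms.intro FA.nonunital_algebra_axioms I_ideal)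

text \<open>\<open>the_elem\<close> is applied to a singleton: two representatives differ by an
  element of \<open>I\<close>, which acts as zero.\<close>

lemma act_coset:
  assumes z: "z \<in> carrier FA" and m: "m \<in> carrier FX"
  shows "act GR (I +>\<^bsub>FA\<^esub> z) m = free_act R X T z m"
proof -
  have "free_act R X T x m = free_act R X T z m" if "x \<in> I +>\<^bsub>FA\<^esub> z" for x
  proof -
    note x = Q.coset_mem[OF z that]
    have "x = (x \<ominus>\<^bsub>FA\<^esub> z) \<oplus>\<^bsub>FA\<^esub> z"
      using FA.M.minus_eq FA.M.a_assoc FA.M.l_neg FA.M.r_zero FA.M.a_inv_closed x(1) z by metis
    then have "free_act R X T x m = free_act R X T (x \<ominus>\<^bsub>FA\<^esub> z) m \<oplus>\<^bsub>FX\<^esub> free_act R X T z m"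
      using linear_maps_add[OF free_act_linear[OF m] FA.M.minus_closed[OF x(1) z] z] by metis
    also have "\<dots> = free_act R X T z m"
      using annihilator_act[OF _ m] x(2) I_annihilator
        FX.M.l_zero[OF linear_maps_closed[OF free_act_linear[OF m] z]] by (metis subsetD)
    finally show ?thesis .
  qed
  then have "(\<lambda>x. free_act R X T x m) ` (I +>\<^bsub>FA\<^esub> z) = {free_act R X T z m}"
    using Q.a_rcos_self[OF z] by blast
  then show ?thesis by (simp add: generated_rep_act)
qed

lemma generated_rep_representation: "alg_representation R QA GR"
proof -
  have cl: "free_act R X T z m \<in> carrier FX" if "z \<in> carrier FA" "m \<in> carrier FX" for z m
    by (rule linear_maps_closed[OF free_act_linear_right[OF that(1)] that(2)])
  interpret GR: module R GR
    by (rule module_cong[OF FX.module_axioms]) simp_all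
  note D = linear_mapsD[OF free_act_linear_right] linear_mapsD[OF free_act_linear]
  show ?thesis
  proof (intro alg_representation.intro alg_representation_axioms.intro)
    show "nonunital_algebra R QA" by (rule Q.nonunital_algebra_quotient)
    show "module R GR" by (rule GR.module_axioms)
  next
    fix Y assume "Y \<in> carrier QA"
    then obtain z where z: "z \<in> carrier FA" and Y: "Y = I +>\<^bsub>FA\<^esub> z"
      unfolding Q.quotient_carrier by blast
    show "act GR Y \<in> linear_maps R GR GR"
      unfolding Y
    proof (rule linear_mapsI)
      fix m m' assume "m \<in> carrier GR" "m' \<in> carrier GR"
      then show "act GR (I +>\<^bsub>FA\<^esub> z) (m \<oplus>\<^bsub>GR\<^esub> m')
        = act GR (I +>\<^bsub>FA\<^esub> z) m \<oplus>\<^bsub>GR\<^esub> act GR (I +>\<^bsub>FA\<^esub> z) m'"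
        unfolding generated_rep_simps using act_coset[OF z] D(2)[OF z] FX.M.a_closed by metis
    next
      fix c m assume "c \<in> carrier R" "m \<in> carrier GR"
      then show "act GR (I +>\<^bsub>FA\<^esub> z) (c \<odot>\<^bsub>GR\<^esub> m) = c \<odot>\<^bsub>GR\<^esub> act GR (I +>\<^bsub>FA\<^esub> z) m"
        unfolding generated_rep_simps using act_coset[OF z] D(3)[OF z] FX.smult_closed by metis
    qed (simp add: act_coset[OF z] cl[OF z])
  next
    fix Y Z m assume "Y \<in> carrier QA" "Z \<in> carrier QA" and m: "m \<in> carrier GR"
    then obtain y z where y: "y \<in> carrier FA" and Y: "Y = I +>\<^bsub>FA\<^esub> y"
      and z: "z \<in> carrier FA" and Z: "Z = I +>\<^bsub>FA\<^esub> z"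
      unfolding Q.quotient_carrier by blast
    have m: "m \<in> carrier FX" using m by simp
    show "act GR (Y \<oplus>\<^bsub>QA\<^esub> Z) m = act GR Y m \<oplus>\<^bsub>GR\<^esub> act GR Z m"
      unfolding Y Z Q.quotient_add[OF y z] act_coset[OF FA.M.a_closed[OF y z] m]
        act_coset[OF y m] act_coset[OF z m] D(5)[OF m y z] by simp
    show "act GR (Y \<otimes>\<^bsub>QA\<^esub> Z) m = act GR Y (act GR Z m)"
      unfolding Y Z Q.quotient_mult[OF y z] act_coset[OF FA.mult_closed[OF y z] m]
        act_coset[OF z m] act_coset[OF y cl[OF z m]] by (rule free_act_mult[OF y z m])
  next
    fix c Y m assume c: "c \<in> carrier R" and "Y \<in> carrier QA" and m: "m \<in> carrier GR"
    then obtain y where y: "y \<in> carrier FA" and Y: "Y = I +>\<^bsub>FA\<^esub> y"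
      unfolding Q.quotient_carrier by blast
    have m: "m \<in> carrier FX" using m by simp
    show "act GR (c \<odot>\<^bsub>QA\<^esub> Y) m = c \<odot>\<^bsub>GR\<^esub> act GR Y m"
      unfolding Y Q.quotient_smult[OF c y] act_coset[OF FA.smult_closed[OF c y] m]
        act_coset[OF y m] D(6)[OF m c y] by simp
  qed
qed

lemma act_gen_basis:
  assumes "g \<in> S" "x \<in> X"
  shows "act GR (I +>\<^bsub>FA\<^esub> basis_vec R [g]) (basis_vec R x) = T g x"
proof -
  have "[g] \<in> words S" using assms by simp
  then have "basis_vec R [g] \<in> carrier FA" by (simp add: basis_vec_carrier)
  then show ?thesis
    using assms by (simp add: act_coset free_act_word basis_vec_carrier gen_basis)
qed

end

section \<open>Subrepresentations, principal left ideals and a criterion for isomorphism\<close>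

lemma alg_representation_subrep:
  assumes "alg_representation k A M" "submodule H k M"
    and act: "\<And>x m. \<lbrakk>x \<in> carrier A; m \<in> H\<rbrakk> \<Longrightarrow> act M x m \<in> H"
  shows "alg_representation k A (M\<lparr>carrier := H\<rparr>)"
proof -
  interpret M: alg_representation k A M by fact
  note H = M.M.submodule_carrier[OF assms(2)]
  show ?thesis
  proof (intro alg_representation.intro alg_representation_axioms.intro)
    show "nonunital_algebra k A" by (rule M.A.nonunital_algebra_axioms)
    show "module k (M\<lparr>carrier := H\<rparr>)"
      by (rule submodule.submodule_is_module[OF assms(2) M.M.module_axioms])
    fix x assume x: "x \<in> carrier A"
    note D = linear_mapsD[OF M.act_linear[OF x]]
    show "act (M\<lparr>carrier := H\<rparr>) x \<in> linear_maps k (M\<lparr>carrier := H\<rparr>) (M\<lparr>carrier := H\<rparr>)"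
      by (rule linear_mapsI) (use x in \<open>simp_all add: act D H\<close>)
  qed (simp_all add: M.act_add M.act_smult M.act_mult H)
qed

lemma alg_representation_left_ideal:
  assumes "nonunital_algebra k A" and e: "e \<in> carrier A"
  shows "alg_representation k A (left_ideal_rep A e)"
proof -
  interpret A: nonunital_algebra k A by fact
  let ?H = "(\<lambda>x. x \<otimes>\<^bsub>A\<^esub> e) ` carrier A"
  have H: "submodule ?H k A"
  proof (rule A.submoduleI')
    show "?H \<subseteq> carrier A" using A.mult_closed e by blast
    show "\<zero>\<^bsub>A\<^esub> \<in> ?H" using A.mult_zero_left[OF e] by force
  next
    fix x y assume "x \<in> ?H" "y \<in> ?H"
    then show "x \<oplus>\<^bsub>A\<^esub> y \<in> ?H" using e by (auto simp: A.mult_l_distr[symmetric])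
  next
    fix c x assume "c \<in> carrier k" "x \<in> ?H"
    then show "c \<odot>\<^bsub>A\<^esub> x \<in> ?H" using e by (auto simp: A.smult_mult_left[symmetric])
  qed
  have M: "module k (left_ideal_rep A e)"
    by (rule module_cong[OF submodule.submodule_is_module[OF H A.module_axioms]])
      (simp_all add: left_ideal_rep_def)
  show ?thesis
  proof (intro alg_representation.intro alg_representation_axioms.intro M assms(1))
    fix x assume x: "x \<in> carrier A"
    show "act (left_ideal_rep A e) x \<in> linear_maps k (left_ideal_rep A e) (left_ideal_rep A e)"
      by (rule linear_mapsI)
        (use x e in \<open>auto simp: left_ideal_rep_def A.mult_r_distr A.smult_mult_right A.mult_closed
          A.mult_assoc[symmetric]\<close>)
  qed (use e in \<open>auto simp: left_ideal_rep_def A.mult_l_distr A.smult_mult_left A.mult_closed A.mult_assoc\<close>)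
qed

text \<open>The hypotheses on \<open>\<psi>\<close> make it a left inverse of the map \<open>x \<mapsto> x.v\<close> on \<open>A e\<close>.\<close>

lemma rep_isomorphic_left_ideal:
  assumes N: "alg_representation k A N"
    and e: "e \<in> carrier A" "e \<otimes>\<^bsub>A\<^esub> e = e"
    and v: "v \<in> carrier N" "act N e v = v"
    and surj: "\<And>n. n \<in> carrier N \<Longrightarrow> \<exists>x\<in>carrier A. act N x v = n"
    and \<psi>: "\<And>x n. \<lbrakk>x \<in> carrier A; n \<in> carrier N\<rbrakk> \<Longrightarrow> \<psi> (act N x n) = x \<otimes>\<^bsub>A\<^esub> \<psi> n"
      "\<psi> v = e"
  shows "rep_isomorphic k A (left_ideal_rep A e) N"
proof -
  interpret N: alg_representation k A N by fact
  let ?L = "left_ideal_rep A e" and ?\<phi> = "\<lambda>x. act N x v"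
  have L: "carrier ?L = (\<lambda>x. x \<otimes>\<^bsub>A\<^esub> e) ` carrier A" by (simp add: left_ideal_rep_def)
  have LA: "x \<in> carrier A" if "x \<in> carrier ?L" for x
    using that e N.A.mult_closed by (auto simp: L)
  have cl: "act N x v \<in> carrier N" if "x \<in> carrier A" for x
    by (rule linear_maps_closed[OF N.act_linear[OF that] v(1)])
  have xe: "x \<otimes>\<^bsub>A\<^esub> e = x" if "x \<in> carrier ?L" for x
    using that e by (auto simp: L N.A.mult_assoc)
  have "inj_on ?\<phi> (carrier ?L)"
    by (rule inj_on_inverseI[where g = \<psi>]) (use \<psi> v LA xe in simp)
  moreover have "?\<phi> ` carrier ?L = carrier N"
  proof (intro equalityI subsetI)
    fix n assume "n \<in> carrier N"
    then obtain x where x: "x \<in> carrier A" "act N x v = n" using surj by blast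
    \<comment> \<open>The preimage \<open>x\<close> need not lie in \<open>A e\<close>. The product
      \<open>x e\<close> does, and it has the same effect on \<open>v\<close> because
      \<open>e.v = v\<close>.\<close>
    then have "act N (x \<otimes>\<^bsub>A\<^esub> e) v = n" using e v by (simp add: N.act_mult)
    then show "n \<in> ?\<phi> ` carrier ?L" using x by (auto simp: L)
  qed (use cl LA in auto)
  moreover have "?\<phi> \<in> linear_maps k ?L N"
  proof (rule linear_mapsI)
    show "?\<phi> (m \<oplus>\<^bsub>?L\<^esub> m') = ?\<phi> m \<oplus>\<^bsub>N\<^esub> ?\<phi> m'" if "m \<in> carrier ?L" "m' \<in> carrier ?L" for m m'
      using N.act_add[OF LA LA v(1)] that by (simp add: left_ideal_rep_def)
    show "?\<phi> (c \<odot>\<^bsub>?L\<^esub> m) = c \<odot>\<^bsub>N\<^esub> ?\<phi> m" if "c \<in> carrier k" "m \<in> carrier ?L" for c m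
      using N.act_smult[OF _ LA v(1)] that by (simp add: left_ideal_rep_def)
  qed (use cl LA in blast)
  moreover have "?\<phi> (act ?L x m) = act N x (?\<phi> m)" if "x \<in> carrier A" "m \<in> carrier ?L" for x m
    using N.act_mult[OF that(1) LA[OF that(2)] v(1)] by (simp add: left_ideal_rep_def)
  ultimately show ?thesis
    unfolding rep_isomorphic_def bij_betw_def
    using alg_representation_left_ideal[OF N.A.nonunital_algebra_axioms e(1)] N by blast
qed

section \<open>The relations of the Leavitt path algebra\<close>

locale leavitt_algebra = cring k + wf_digraph Q
  for k :: "('k, 'r) ring_scheme" (structure) and Q :: "('v, 'a) pre_digraph"
begin

abbreviation "FL \<equiv> lpa_free k Q"
abbreviation "L \<equiv> leavitt k Q"
abbreviation "gen \<equiv> leavitt_gen k Q"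

sublocale FL: nonunital_algebra k FL
  unfolding lpa_free_def by (rule nonunital_algebra_free_algebra)

lemma FL_carrier: "carrier FL = carrier (free_module k (words (lpa_gens Q)))"
  by (simp add: lpa_free_def)

lemma FL_word: "\<lbrakk>w \<noteq> []; set w \<subseteq> lpa_gens Q\<rbrakk> \<Longrightarrow> basis_vec k w \<in> carrier FL"
  unfolding FL_carrier by (rule basis_vec_carrier) simp

lemma lpa_gens_iff [simp]:
  "Vertex i \<in> lpa_gens Q \<longleftrightarrow> i \<in> verts Q"
  "Arrow \<alpha> \<in> lpa_gens Q \<longleftrightarrow> \<alpha> \<in> arcs Q"
  "Star \<alpha> \<in> lpa_gens Q \<longleftrightarrow> \<alpha> \<in> arcs Q"
  by (auto simp: lpa_gens_def)

lemma FL_finsum: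
  "(\<Oplus>\<^bsub>FL\<^esub>\<alpha> \<in> out_arcs Q i. basis_vec k [Star \<alpha>, Arrow \<alpha>]) \<in> carrier FL"
  by (rule FL.M.finsum_closed) (auto intro!: FL_word)

lemma lpa_relations_closed: "lpa_relations k Q \<subseteq> carrier FL"
proof -
  have 0: "basis_vec k [Vertex i, Vertex j] \<ominus>\<^bsub>FL\<^esub> (if i = j then basis_vec k [Vertex i] else \<zero>\<^bsub>FL\<^esub>) \<in> carrier FL"
    if "i \<in> verts Q" "j \<in> verts Q" for i j
    using that FL.M.zero_closed by (intro FL.M.minus_closed) (auto intro!: FL_word)
  have 1: "basis_vec k [Vertex (head Q \<alpha>), Arrow \<alpha>] \<ominus>\<^bsub>FL\<^esub> basis_vec k [Arrow \<alpha>] \<in> carrier FL"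
    "basis_vec k [Arrow \<alpha>, Vertex (tail Q \<alpha>)] \<ominus>\<^bsub>FL\<^esub> basis_vec k [Arrow \<alpha>] \<in> carrier FL"
    "basis_vec k [Vertex (tail Q \<alpha>), Star \<alpha>] \<ominus>\<^bsub>FL\<^esub> basis_vec k [Star \<alpha>] \<in> carrier FL"
    "basis_vec k [Star \<alpha>, Vertex (head Q \<alpha>)] \<ominus>\<^bsub>FL\<^esub> basis_vec k [Star \<alpha>] \<in> carrier FL"
    if "\<alpha> \<in> arcs Q" for \<alpha>
    using that by (auto intro!: FL.M.minus_closed FL_word)
  have 2: "basis_vec k [Arrow \<alpha>, Star \<beta>]
      \<ominus>\<^bsub>FL\<^esub> (if \<alpha> = \<beta> then basis_vec k [Vertex (head Q \<alpha>)] else \<zero>\<^bsub>FL\<^esub>) \<in> carrier FL"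
    if "\<alpha> \<in> arcs Q" "\<beta> \<in> arcs Q" for \<alpha> \<beta>
    using that FL.M.zero_closed by (intro FL.M.minus_closed) (auto intro!: FL_word)
  have 3: "(\<Oplus>\<^bsub>FL\<^esub>\<alpha> \<in> out_arcs Q i. basis_vec k [Star \<alpha>, Arrow \<alpha>]) \<ominus>\<^bsub>FL\<^esub> basis_vec k [Vertex i] \<in> carrier FL"
    if "regular_vertex Q i" for i
    using that by (intro FL.M.minus_closed FL_finsum FL_word) (auto simp: regular_vertex_def)
  show ?thesis
    unfolding lpa_relations_def Let_def using 0 1 2 3 by blast
qed

sublocale L: algebra_quotient k FL "lpa_ideal k Q"
  unfolding lpa_ideal_def
  by (intro algebra_quotient.intro algebra_quotient_axioms.intro FL.nonunital_algebra_axioms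
      FL.algebra_ideal_gen_algebra_ideal lpa_relations_closed)

sublocale LA: nonunital_algebra k L
  unfolding leavitt_def by (rule L.nonunital_algebra_quotient)

lemma gen_closed: "g \<in> lpa_gens Q \<Longrightarrow> gen g \<in> carrier L"
  unfolding leavitt_def leavitt_gen_def L.quotient_carrier by (intro imageI FL_word) auto

lemma gen_mult:
  assumes "g \<in> lpa_gens Q" "h \<in> lpa_gens Q"
  shows "gen g \<otimes>\<^bsub>L\<^esub> gen h = lpa_ideal k Q +>\<^bsub>FL\<^esub> basis_vec k [g, h]"
proof -
  have "[g] \<in> words (lpa_gens Q)" "[h] \<in> words (lpa_gens Q)" using assms by auto
  from free_algebra_mult_basis[OF this] show ?thesis
    unfolding leavitt_def leavitt_gen_def
    using assms by (subst L.quotient_mult) (auto simp: lpa_free_def basis_vec_carrier)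
qed

lemma coset_relation:
  assumes "x \<ominus>\<^bsub>FL\<^esub> y \<in> lpa_relations k Q" "x \<in> carrier FL" "y \<in> carrier FL"
  shows "lpa_ideal k Q +>\<^bsub>FL\<^esub> x = lpa_ideal k Q +>\<^bsub>FL\<^esub> y"
  unfolding L.coset_eq_iff[OF assms(2,3)] unfolding lpa_ideal_def
  by (rule subsetD[OF FL.gen_algebra_ideal_incl assms(1)])

lemma coset_zero_L: "lpa_ideal k Q +>\<^bsub>FL\<^esub> \<zero>\<^bsub>FL\<^esub> = \<zero>\<^bsub>L\<^esub>"
  unfolding leavitt_def by (rule L.quotient_zero[symmetric])

lemma gen_mult_relation:
  assumes "basis_vec k [g, h] \<ominus>\<^bsub>FL\<^esub> y \<in> lpa_relations k Q"
    and "g \<in> lpa_gens Q" "h \<in> lpa_gens Q" "y \<in> carrier FL"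
  shows "gen g \<otimes>\<^bsub>L\<^esub> gen h = lpa_ideal k Q +>\<^bsub>FL\<^esub> y"
  unfolding gen_mult[OF assms(2,3)]
  by (rule coset_relation) (use assms in \<open>auto intro!: FL_word\<close>)

lemma vertex_vertex:
  assumes "i \<in> verts Q" "j \<in> verts Q"
  shows "gen (Vertex i) \<otimes>\<^bsub>L\<^esub> gen (Vertex j) = (if i = j then gen (Vertex i) else \<zero>\<^bsub>L\<^esub>)"
proof -
  have "gen (Vertex i) \<otimes>\<^bsub>L\<^esub> gen (Vertex j)
      = lpa_ideal k Q +>\<^bsub>FL\<^esub> (if i = j then basis_vec k [Vertex i] else \<zero>\<^bsub>FL\<^esub>)"
  proof (rule gen_mult_relation)
    show "basis_vec k [Vertex i, Vertex j] \<ominus>\<^bsub>FL\<^esub> (if i = j then basis_vec k [Vertex i] else \<zero>\<^bsub>FL\<^esub>)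
      \<in> lpa_relations k Q"
      unfolding lpa_relations_def Let_def using assms by blast
  qed (use assms FL.M.zero_closed in \<open>auto intro!: FL_word\<close>)
  then show ?thesis by (auto simp: coset_zero_L leavitt_gen_def)
qed

lemma arrow_star:
  assumes "\<alpha> \<in> arcs Q" "\<beta> \<in> arcs Q"
  shows "gen (Arrow \<alpha>) \<otimes>\<^bsub>L\<^esub> gen (Star \<beta>) = (if \<alpha> = \<beta> then gen (Vertex (head Q \<alpha>)) else \<zero>\<^bsub>L\<^esub>)"
proof -
  have "gen (Arrow \<alpha>) \<otimes>\<^bsub>L\<^esub> gen (Star \<beta>)
      = lpa_ideal k Q +>\<^bsub>FL\<^esub> (if \<alpha> = \<beta> then basis_vec k [Vertex (head Q \<alpha>)] else \<zero>\<^bsub>FL\<^esub>)"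
  proof (rule gen_mult_relation)
    show "basis_vec k [Arrow \<alpha>, Star \<beta>]
        \<ominus>\<^bsub>FL\<^esub> (if \<alpha> = \<beta> then basis_vec k [Vertex (head Q \<alpha>)] else \<zero>\<^bsub>FL\<^esub>) \<in> lpa_relations k Q"
      unfolding lpa_relations_def Let_def using assms by blast
  qed (use assms FL.M.zero_closed in \<open>auto intro!: FL_word\<close>)
  then show ?thesis by (auto simp: coset_zero_L leavitt_gen_def)
qed

lemma
  assumes \<alpha>: "\<alpha> \<in> arcs Q"
  shows head_arrow: "gen (Vertex (head Q \<alpha>)) \<otimes>\<^bsub>L\<^esub> gen (Arrow \<alpha>) = gen (Arrow \<alpha>)"
    and arrow_tail: "gen (Arrow \<alpha>) \<otimes>\<^bsub>L\<^esub> gen (Vertex (tail Q \<alpha>)) = gen (Arrow \<alpha>)"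
    and tail_star: "gen (Vertex (tail Q \<alpha>)) \<otimes>\<^bsub>L\<^esub> gen (Star \<alpha>) = gen (Star \<alpha>)"
    and star_head: "gen (Star \<alpha>) \<otimes>\<^bsub>L\<^esub> gen (Vertex (head Q \<alpha>)) = gen (Star \<alpha>)"
proof -
  have rel: "basis_vec k [Vertex (head Q \<alpha>), Arrow \<alpha>] \<ominus>\<^bsub>FL\<^esub> basis_vec k [Arrow \<alpha>] \<in> lpa_relations k Q"
    "basis_vec k [Arrow \<alpha>, Vertex (tail Q \<alpha>)] \<ominus>\<^bsub>FL\<^esub> basis_vec k [Arrow \<alpha>] \<in> lpa_relations k Q"
    "basis_vec k [Vertex (tail Q \<alpha>), Star \<alpha>] \<ominus>\<^bsub>FL\<^esub> basis_vec k [Star \<alpha>] \<in> lpa_relations k Q"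
    "basis_vec k [Star \<alpha>, Vertex (head Q \<alpha>)] \<ominus>\<^bsub>FL\<^esub> basis_vec k [Star \<alpha>] \<in> lpa_relations k Q"
    unfolding lpa_relations_def Let_def using \<alpha> by blast+
  note eqs = rel[THEN gen_mult_relation, folded leavitt_gen_def]
  show "gen (Vertex (head Q \<alpha>)) \<otimes>\<^bsub>L\<^esub> gen (Arrow \<alpha>) = gen (Arrow \<alpha>)"
    "gen (Arrow \<alpha>) \<otimes>\<^bsub>L\<^esub> gen (Vertex (tail Q \<alpha>)) = gen (Arrow \<alpha>)"
    "gen (Vertex (tail Q \<alpha>)) \<otimes>\<^bsub>L\<^esub> gen (Star \<alpha>) = gen (Star \<alpha>)"
    "gen (Star \<alpha>) \<otimes>\<^bsub>L\<^esub> gen (Vertex (head Q \<alpha>)) = gen (Star \<alpha>)"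
    by (rule eqs; use \<alpha> in \<open>auto intro!: FL_word\<close>)+
qed

text \<open>At a vertex with a single outgoing arrow the sum in relation (4) has one summand. This
  is how linear vertices let an arrow cancel against its star from the left.\<close>

lemma star_arrow:
  assumes "\<alpha> \<in> arcs Q" and out: "out_arcs Q (tail Q \<alpha>) = {\<alpha>}"
  shows "gen (Star \<alpha>) \<otimes>\<^bsub>L\<^esub> gen (Arrow \<alpha>) = gen (Vertex (tail Q \<alpha>))"
proof -
  have w: "basis_vec k [Star \<alpha>, Arrow \<alpha>] \<in> carrier FL" using assms by (intro FL_word) auto
  have sum: "(\<Oplus>\<^bsub>FL\<^esub>\<beta> \<in> out_arcs Q (tail Q \<alpha>). basis_vec k [Star \<beta>, Arrow \<beta>]) = basis_vec k [Star \<alpha>, Arrow \<alpha>]"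
    unfolding out using w FL.M.finsum_insert[of "{}" \<alpha> "\<lambda>\<beta>. basis_vec k [Star \<beta>, Arrow \<beta>]"]
    by (simp add: FL.M.finsum_empty)
  have "regular_vertex Q (tail Q \<alpha>)"
    using assms by (simp add: regular_vertex_def sink_def infinite_emitter_def)
  then have "(\<Oplus>\<^bsub>FL\<^esub>\<beta> \<in> out_arcs Q (tail Q \<alpha>). basis_vec k [Star \<beta>, Arrow \<beta>])
      \<ominus>\<^bsub>FL\<^esub> basis_vec k [Vertex (tail Q \<alpha>)] \<in> lpa_relations k Q"
    unfolding lpa_relations_def Let_def by blast
  then show ?thesis
    unfolding sum leavitt_gen_def[of k Q "Vertex _"]
    by (rule gen_mult_relation) (use assms in \<open>auto intro!: FL_word\<close>)
qed

lemma leavitt_induct [consumes 1, case_names zero gen add smult mult]: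
  assumes "x \<in> carrier L"
    and "P \<zero>\<^bsub>L\<^esub>"
    and "\<And>g. g \<in> lpa_gens Q \<Longrightarrow> P (gen g)"
    and "\<And>x y. \<lbrakk>x \<in> carrier L; y \<in> carrier L; P x; P y\<rbrakk> \<Longrightarrow> P (x \<oplus>\<^bsub>L\<^esub> y)"
    and "\<And>c x. \<lbrakk>c \<in> carrier k; x \<in> carrier L; P x\<rbrakk> \<Longrightarrow> P (c \<odot>\<^bsub>L\<^esub> x)"
    and "\<And>x y. \<lbrakk>x \<in> carrier L; y \<in> carrier L; P x; P y\<rbrakk> \<Longrightarrow> P (x \<otimes>\<^bsub>L\<^esub> y)"
  shows "P x"
  using free_algebra_quotient_induct[OF L.algebra_quotient_axioms[unfolded lpa_free_def], of x P]
    assms unfolding leavitt_def leavitt_gen_def lpa_free_def by blast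

end

section \<open>Representations on spaces of paths\<close>

text \<open>
  Both representations are instances of one construction: a basis element \<open>x\<close> starts at the vertex
  \<open>\<sigma> x\<close>, \<open>fst_arc x\<close> is its first arrow if there is one, \<open>rest x\<close> is \<open>x\<close> without its first arrow, and
  \<open>cons \<alpha> x\<close> is \<open>x\<alpha>\<close>.
\<close>

locale path_space = leavitt_algebra k Q
  for k :: "('k, 'r) ring_scheme" (structure) and Q :: "('v, 'a) pre_digraph" +
  fixes X :: "'x set" and \<sigma> :: "'x \<Rightarrow> 'v" and fst_arc :: "'x \<Rightarrow> 'a option"
    and rest :: "'x \<Rightarrow> 'x" and cons :: "'a \<Rightarrow> 'x \<Rightarrow> 'x"
    and T :: "('v, 'a) lpa_gen \<Rightarrow> 'x \<Rightarrow> 'x \<Rightarrow> 'k"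
  assumes start_vert: "x \<in> X \<Longrightarrow> \<sigma> x \<in> verts Q"
    and fst_arc_None: "\<lbrakk>x \<in> X; fst_arc x = None\<rbrakk> \<Longrightarrow> out_arcs Q (\<sigma> x) = {}"
    and fst_arc_Some: "\<lbrakk>x \<in> X; fst_arc x = Some \<alpha>\<rbrakk> \<Longrightarrow> \<alpha> \<in> arcs Q \<and> tail Q \<alpha> = \<sigma> x \<and> rest x \<in> X
      \<and> \<sigma> (rest x) = head Q \<alpha> \<and> cons \<alpha> (rest x) = x"
    and cons: "\<lbrakk>x \<in> X; \<alpha> \<in> arcs Q; head Q \<alpha> = \<sigma> x\<rbrakk> \<Longrightarrow> cons \<alpha> x \<in> X
      \<and> \<sigma> (cons \<alpha> x) = tail Q \<alpha> \<and> fst_arc (cons \<alpha> x) = Some \<alpha> \<and> rest (cons \<alpha> x) = x"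
    and T_Vertex: "T (Vertex i) x = (if i = \<sigma> x then basis_vec k x else (\<lambda>_. \<zero>))"
    and T_Arrow: "T (Arrow \<alpha>) x = (if fst_arc x = Some \<alpha> then basis_vec k (rest x) else (\<lambda>_. \<zero>))"
    and T_Star: "T (Star \<alpha>) x = (if head Q \<alpha> = \<sigma> x then basis_vec k (cons \<alpha> x) else (\<lambda>_. \<zero>))"
begin

lemmas T_simps = T_Vertex T_Arrow T_Star

lemma zero_free_module: "(\<lambda>_. \<zero>) \<in> carrier (free_module k Y)"
  by (simp add: free_module_carrier_iff)

sublocale G: generators_action k "lpa_gens Q" X T
proof unfold_locales
  fix g x assume "g \<in> lpa_gens Q" "x \<in> X"
  then show "T g x \<in> carrier (free_module k X)"
    using fst_arc_Some cons
    by (cases g) (auto simp: T_simps zero_free_module intro!: basis_vec_carrier)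
qed

lemma free_act_gen: "g \<in> lpa_gens Q \<Longrightarrow> x \<in> X \<Longrightarrow> free_act k X T (basis_vec k [g]) (basis_vec k x) = T g x"
  by (simp add: G.free_act_word basis_vec_carrier G.gen_basis)

lemma free_act_gen_gen:
  assumes "g \<in> lpa_gens Q" "h \<in> lpa_gens Q" "x \<in> X"
  shows "free_act k X T (basis_vec k [g, h]) (basis_vec k x) = lin_ext k (free_module k X) (T g) (T h x)"
  using assms by (simp add: G.free_act_word basis_vec_carrier G.gen_basis)

lemma gen_zero:
  assumes "g \<in> lpa_gens Q"
  shows "lin_ext k (free_module k X) (T g) (\<lambda>_. \<zero>) = (\<lambda>_. \<zero>)"
  using linear_maps_zero[OF G.gen_linear[OF assms] module_free_module module_free_module] by simp

text \<open>Relations are stored as differences, so a relation acts as zero once its two sides act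
  alike on basis vectors.\<close>

lemma annihilator_minus:
  assumes x: "x \<in> carrier FL" and y: "y \<in> carrier FL"
    and eq: "\<And>b. b \<in> X \<Longrightarrow> free_act k X T x (basis_vec k b) = free_act k X T y (basis_vec k b)"
  shows "x \<ominus>\<^bsub>FL\<^esub> y \<in> G.annihilator"
proof -
  have "free_act k X T (x \<ominus>\<^bsub>FL\<^esub> y) (basis_vec k b) = \<zero>\<^bsub>free_module k X\<^esub>" if b: "b \<in> X" for b
  proof -
    note bv = basis_vec_carrier[OF b]
    note D = linear_mapsD[OF G.free_act_linear[OF bv], folded lpa_free_def]
    have "x \<ominus>\<^bsub>FL\<^esub> y = x \<oplus>\<^bsub>FL\<^esub> (\<ominus> \<one>) \<odot>\<^bsub>FL\<^esub> y"
      using y by (simp add: FL.M.minus_eq FL.smult_l_minus)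
    then have "free_act k X T (x \<ominus>\<^bsub>FL\<^esub> y) (basis_vec k b)
        = free_act k X T y (basis_vec k b) \<oplus>\<^bsub>free_module k X\<^esub> (\<ominus> \<one>) \<odot>\<^bsub>free_module k X\<^esub> free_act k X T y (basis_vec k b)"
      using x y D(2)[of x "(\<ominus> \<one>) \<odot>\<^bsub>FL\<^esub> y"] D(3)[of "\<ominus> \<one>" y] eq[OF b] FL.smult_closed by simp
    also have "\<dots> = \<zero>\<^bsub>free_module k X\<^esub>"
      using D(1)[OF y] G.FX.M.r_neg G.FX.smult_l_minus[of \<one>] G.FX.smult_one by simp
    finally show ?thesis .
  qed
  then show ?thesis
    using FL.M.minus_closed[OF x y] unfolding G.annihilator_def lpa_free_def by blast
qed

text \<open>The summand of \<alpha> removes and restores the first arrow of \<open>x\<close> if that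
  arrow is \<alpha>, and kills \<open>x\<close> otherwise, so at most one summand counts. If
  \<open>x\<close> starts at the regular vertex \<open>i\<close>, there is such a summand: without a
  first arrow, \<open>fst_arc_None\<close> would make \<open>i\<close> a sink.\<close>

lemma star_arrow_sum:
  assumes "regular_vertex Q i" "x \<in> X"
  shows "free_act k X T (\<Oplus>\<^bsub>FL\<^esub>\<alpha> \<in> out_arcs Q i. basis_vec k [Star \<alpha>, Arrow \<alpha>]) (basis_vec k x) = T (Vertex i) x"
proof -
  note bv = basis_vec_carrier[OF assms(2)]
  note lin = G.free_act_linear[OF bv, folded lpa_free_def]
  have summand: "free_act k X T (basis_vec k [Star \<alpha>, Arrow \<alpha>]) (basis_vec k x)
      = (if fst_arc x = Some \<alpha> then basis_vec k x else (\<lambda>_. \<zero>))" if "\<alpha> \<in> out_arcs Q i" for \<alpha>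
    using that assms fst_arc_Some[OF assms(2)]
    by (auto simp: free_act_gen_gen T_Arrow T_Star G.gen_basis gen_zero)
  \<comment> \<open>Stated for all finite sets of outgoing arrows to permit induction; regularity of
    \<open>i\<close> makes the full set finite.\<close>
  have sum: "free_act k X T (\<Oplus>\<^bsub>FL\<^esub>\<alpha> \<in> B. basis_vec k [Star \<alpha>, Arrow \<alpha>]) (basis_vec k x)
      = (if \<exists>\<alpha> \<in> B. fst_arc x = Some \<alpha> then basis_vec k x else (\<lambda>_. \<zero>))"
    if "finite B" "B \<subseteq> out_arcs Q i" for B
    using that
  proof (induction B rule: finite_induct)
    case empty
    then show ?case
      using linear_maps_zero[OF lin FL.module_axioms G.FX.module_axioms] by (simp add: FL.M.finsum_empty)
  next
    case (insert \<alpha> B)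
    have w: "basis_vec k [Star \<beta>, Arrow \<beta>] \<in> carrier FL" if "\<beta> \<in> insert \<alpha> B" for \<beta>
      using that insert.prems by (intro FL_word) auto
    have "(\<Oplus>\<^bsub>FL\<^esub>\<alpha> \<in> B. basis_vec k [Star \<alpha>, Arrow \<alpha>]) \<in> carrier FL"
      using w by (intro FL.M.finsum_closed) auto
    then have "free_act k X T (\<Oplus>\<^bsub>FL\<^esub>\<alpha> \<in> insert \<alpha> B. basis_vec k [Star \<alpha>, Arrow \<alpha>]) (basis_vec k x)
        = free_act k X T (basis_vec k [Star \<alpha>, Arrow \<alpha>]) (basis_vec k x)
          \<oplus>\<^bsub>free_module k X\<^esub> free_act k X T (\<Oplus>\<^bsub>FL\<^esub>\<alpha> \<in> B. basis_vec k [Star \<alpha>, Arrow \<alpha>]) (basis_vec k x)"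
      using w insert.hyps linear_maps_add[OF lin] by (subst FL.M.finsum_insert) auto
    then show ?case
      using insert summand[of \<alpha>] free_module_apply[OF bv] by (auto simp: fun_eq_iff)
  qed
  have "finite (out_arcs Q i)" "out_arcs Q i \<noteq> {}" "i \<in> verts Q"
    using assms(1) by (auto simp: regular_vertex_def sink_def infinite_emitter_def)
  moreover have "(\<exists>\<alpha> \<in> out_arcs Q i. fst_arc x = Some \<alpha>) \<longleftrightarrow> i = \<sigma> x"
    using calculation(2) fst_arc_Some[OF assms(2)] fst_arc_None[OF assms(2)]
    by (cases "fst_arc x") auto
  ultimately show ?thesis using sum[of "out_arcs Q i"] by (simp add: T_Vertex)
qed

text \<open>This is the well-definedness of the action of \<open>L\<close>: the annihilator is an
  ideal, so it contains the ideal generated by the relations, and cosets act.\<close>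

lemma relations_annihilator: "lpa_relations k Q \<subseteq> G.annihilator"
proof -
  have zero: "free_act k X T \<zero>\<^bsub>FL\<^esub> (basis_vec k x) = (\<lambda>_. \<zero>)" if "x \<in> X" for x
    using linear_maps_zero[OF G.free_act_linear[OF basis_vec_carrier[OF that], folded lpa_free_def]
        FL.module_axioms G.FX.module_axioms] by simp
  note simps = free_act_gen free_act_gen_gen T_simps G.gen_basis gen_zero zero
  have 0: "basis_vec k [Vertex i, Vertex j] \<ominus>\<^bsub>FL\<^esub> (if i = j then basis_vec k [Vertex i] else \<zero>\<^bsub>FL\<^esub>) \<in> G.annihilator"
    if "i \<in> verts Q" "j \<in> verts Q" for i j
    using that FL.M.zero_closed
    by (intro annihilator_minus) (auto simp: simps intro!: FL_word)
  have 1: "basis_vec k [Vertex (head Q \<alpha>), Arrow \<alpha>] \<ominus>\<^bsub>FL\<^esub> basis_vec k [Arrow \<alpha>] \<in> G.annihilator"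
    "basis_vec k [Arrow \<alpha>, Vertex (tail Q \<alpha>)] \<ominus>\<^bsub>FL\<^esub> basis_vec k [Arrow \<alpha>] \<in> G.annihilator"
    "basis_vec k [Vertex (tail Q \<alpha>), Star \<alpha>] \<ominus>\<^bsub>FL\<^esub> basis_vec k [Star \<alpha>] \<in> G.annihilator"
    "basis_vec k [Star \<alpha>, Vertex (head Q \<alpha>)] \<ominus>\<^bsub>FL\<^esub> basis_vec k [Star \<alpha>] \<in> G.annihilator"
    if "\<alpha> \<in> arcs Q" for \<alpha>
    by (rule annihilator_minus;
        use that in \<open>auto simp: simps intro!: FL_word dest: fst_arc_Some cons\<close>)+
  have 3: "basis_vec k [Arrow \<alpha>, Star \<beta>]
      \<ominus>\<^bsub>FL\<^esub> (if \<alpha> = \<beta> then basis_vec k [Vertex (head Q \<alpha>)] else \<zero>\<^bsub>FL\<^esub>) \<in> G.annihilator"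
    if "\<alpha> \<in> arcs Q" "\<beta> \<in> arcs Q" for \<alpha> \<beta>
    using that FL.M.zero_closed cons
    by (intro annihilator_minus) (auto simp: simps intro!: FL_word)
  have 4: "(\<Oplus>\<^bsub>FL\<^esub>\<alpha> \<in> out_arcs Q i. basis_vec k [Star \<alpha>, Arrow \<alpha>]) \<ominus>\<^bsub>FL\<^esub> basis_vec k [Vertex i] \<in> G.annihilator"
    if "regular_vertex Q i" for i
    by (rule annihilator_minus; use that FL_finsum star_arrow_sum in
        \<open>auto simp: free_act_gen regular_vertex_def intro!: FL_word\<close>)
  show ?thesis
    unfolding lpa_relations_def Let_def using 0 1 3 4 by blast
qed

sublocale G: quotient_action k "lpa_gens Q" X T "lpa_ideal k Q"
proof unfold_locales
  show "algebra_ideal k (free_algebra k (lpa_gens Q)) (lpa_ideal k Q)"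
    using L.ideal unfolding lpa_free_def .
  show "lpa_ideal k Q \<subseteq> G.annihilator"
    unfolding lpa_ideal_def lpa_free_def
    by (rule G.FA.gen_algebra_ideal_least[OF G.annihilator_ideal relations_annihilator])
qed

abbreviation "GR \<equiv> generated_rep k X T"

lemma leavitt_representation: "alg_representation k L GR"
  using G.generated_rep_representation unfolding leavitt_def lpa_free_def .

lemma act_gen: "\<lbrakk>g \<in> lpa_gens Q; x \<in> X\<rbrakk> \<Longrightarrow> act GR (gen g) (basis_vec k x) = T g x"
  using G.act_gen_basis unfolding leavitt_gen_def lpa_free_def .

end

section \<open>Line points\<close>

lemma (in alg_representation) act_zero:
  assumes m: "m \<in> carrier M"
  shows "act M \<zero>\<^bsub>A\<^esub> m = \<zero>\<^bsub>M\<^esub>"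
proof -
  have "act M (\<zero> \<odot>\<^bsub>A\<^esub> \<zero>\<^bsub>A\<^esub>) m = \<zero> \<odot>\<^bsub>M\<^esub> act M \<zero>\<^bsub>A\<^esub> m"
    by (rule act_smult) (use m in auto)
  then show ?thesis
    using linear_maps_closed[OF act_linear[OF A.M.zero_closed] m] by simp
qed

section \<open>Removing arrows from a path, and paths as operators on \<open>L\<close>\<close>

context path_space
begin

text \<open>The common form of \<open>tau_gt\<close> on infinite paths and of dropping a prefix of a
  finite one: \<open>y\<close> consists of the arrows of \<open>q\<close> followed by
  \<open>z\<close>.\<close>

primrec run :: "'x \<Rightarrow> 'a list \<Rightarrow> 'x \<Rightarrow> bool" where
  "run y [] z \<longleftrightarrow> z = y"
| "run y (\<alpha> # q) z \<longleftrightarrow> fst_arc y = Some \<alpha> \<and> run (rest y) q z"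

lemma run_append: "run y (q @ r) z \<longleftrightarrow> (\<exists>w. run y q w \<and> run w r z)"
  by (induction q arbitrary: y) auto

lemma run_awalk: "\<lbrakk>run y q z; y \<in> X\<rbrakk> \<Longrightarrow> z \<in> X \<and> awalk (\<sigma> y) q (\<sigma> z)"
proof (induction q arbitrary: y)
  case Nil
  then show ?case by (simp add: awalk_Nil_iff start_vert)
next
  case (Cons \<alpha> q)
  have y: "\<alpha> \<in> arcs Q" "tail Q \<alpha> = \<sigma> y" "rest y \<in> X" "\<sigma> (rest y) = head Q \<alpha>"
    using fst_arc_Some[of y \<alpha>] Cons.prems by auto
  then have "z \<in> X" "awalk (head Q \<alpha>) q (\<sigma> z)"
    using Cons.IH[of "rest y"] Cons.prems by auto
  then show ?case using y by (simp add: awalk_Cons_iff)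
qed

text \<open>A path has at most one first arrow, so removal is deterministic and the shorter of two
  initial segments is a prefix of the longer.\<close>

lemma run_extend:
  "\<lbrakk>run y q z; run y q' z'; length q \<le> length q'\<rbrakk> \<Longrightarrow> \<exists>r. q' = q @ r \<and> run z r z'"
proof (induction q arbitrary: y q')
  case Nil
  then show ?case by simp
next
  case (Cons \<alpha> q)
  then obtain q'' where "q' = \<alpha> # q''" by (cases q') auto
  then show ?case using Cons by auto
qed

text \<open>\<open>star_path q u\<close> is \<open>q^* u\<close>, and \<open>arrow_path p u\<close>
  is \<open>p u\<close>. Lists are in order of traversal: the star of the first arrow stands
  leftmost in \<open>q^*\<close>, hence \<open>foldr\<close>, while in \<open>p\<close> the last
  arrow does, hence \<open>fold\<close>. Both are operators because an empty list does not tell its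
  vertex and so names no element of \<open>L\<close>.\<close>

definition star_path :: "'a list \<Rightarrow> (('v, 'a) lpa_gen list \<Rightarrow> 'k) set \<Rightarrow> (('v, 'a) lpa_gen list \<Rightarrow> 'k) set"
  where "star_path q u = foldr (\<lambda>\<alpha> u. gen (Star \<alpha>) \<otimes>\<^bsub>L\<^esub> u) q u"

definition arrow_path :: "'a list \<Rightarrow> (('v, 'a) lpa_gen list \<Rightarrow> 'k) set \<Rightarrow> (('v, 'a) lpa_gen list \<Rightarrow> 'k) set"
  where "arrow_path p u = fold (\<lambda>\<alpha> u. gen (Arrow \<alpha>) \<otimes>\<^bsub>L\<^esub> u) p u"

text \<open>The counterpart in \<open>L\<close> of a path that starts at \<open>i\<close>:
  \<open>u\<close> lies in \<open>e_i L\<close>. It determines the products with vertices and shows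
  which arrows and stars kill \<open>u\<close> for lack of a matching vertex.\<close>

definition starts_at :: "'v \<Rightarrow> (('v, 'a) lpa_gen list \<Rightarrow> 'k) set \<Rightarrow> bool"
  where "starts_at i u \<longleftrightarrow> i \<in> verts Q \<and> u \<in> carrier L \<and> gen (Vertex i) \<otimes>\<^bsub>L\<^esub> u = u"

lemma star_path_simps [simp]:
  "star_path [] u = u"
  "star_path (\<alpha> # q) u = gen (Star \<alpha>) \<otimes>\<^bsub>L\<^esub> star_path q u"
  "star_path (q @ r) u = star_path q (star_path r u)"
  by (simp_all add: star_path_def)

lemma arrow_path_simps [simp]:
  "arrow_path [] u = u"
  "arrow_path (\<alpha> # q) u = arrow_path q (gen (Arrow \<alpha>) \<otimes>\<^bsub>L\<^esub> u)"
  "arrow_path (q @ r) u = arrow_path r (arrow_path q u)"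
  by (simp_all add: arrow_path_def)

lemma starts_at_vertex: "i \<in> verts Q \<Longrightarrow> starts_at i (gen (Vertex i))"
  by (simp add: starts_at_def gen_closed vertex_vertex)

lemma starts_at_arrow:
  assumes "\<alpha> \<in> arcs Q" "u \<in> carrier L"
  shows "starts_at (head Q \<alpha>) (gen (Arrow \<alpha>) \<otimes>\<^bsub>L\<^esub> u)"
  unfolding starts_at_def
  using assms by (simp add: gen_closed LA.mult_closed LA.mult_assoc[symmetric] head_arrow)

lemma starts_at_star:
  assumes "\<alpha> \<in> arcs Q" "u \<in> carrier L"
  shows "starts_at (tail Q \<alpha>) (gen (Star \<alpha>) \<otimes>\<^bsub>L\<^esub> u)"
  unfolding starts_at_def
  using assms by (simp add: gen_closed LA.mult_closed LA.mult_assoc[symmetric] tail_star)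

lemma vertex_mult:
  assumes "starts_at i u" "j \<in> verts Q"
  shows "gen (Vertex j) \<otimes>\<^bsub>L\<^esub> u = (if j = i then u else \<zero>\<^bsub>L\<^esub>)"
proof -
  have u: "u \<in> carrier L" "i \<in> verts Q" "gen (Vertex i) \<otimes>\<^bsub>L\<^esub> u = u"
    using assms unfolding starts_at_def by auto
  have "gen (Vertex j) \<otimes>\<^bsub>L\<^esub> u = (gen (Vertex j) \<otimes>\<^bsub>L\<^esub> gen (Vertex i)) \<otimes>\<^bsub>L\<^esub> u"
    using u assms(2) by (simp add: LA.mult_assoc gen_closed)
  then show ?thesis using u assms(2) by (simp add: vertex_vertex LA.mult_zero_left)
qed

lemma star_mult_zero:
  assumes "starts_at i u" "\<alpha> \<in> arcs Q" "head Q \<alpha> \<noteq> i"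
  shows "gen (Star \<alpha>) \<otimes>\<^bsub>L\<^esub> u = \<zero>\<^bsub>L\<^esub>"
proof -
  have "gen (Star \<alpha>) \<otimes>\<^bsub>L\<^esub> u = gen (Star \<alpha>) \<otimes>\<^bsub>L\<^esub> (gen (Vertex (head Q \<alpha>)) \<otimes>\<^bsub>L\<^esub> u)"
    using assms unfolding starts_at_def
    by (simp add: LA.mult_assoc[symmetric] gen_closed star_head)
  then show ?thesis
    using vertex_mult[OF assms(1)] assms by (simp add: LA.mult_zero_right gen_closed)
qed

lemma arrow_mult_zero:
  assumes "starts_at i u" "\<alpha> \<in> arcs Q" "tail Q \<alpha> \<noteq> i"
  shows "gen (Arrow \<alpha>) \<otimes>\<^bsub>L\<^esub> u = \<zero>\<^bsub>L\<^esub>"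
proof -
  have "gen (Arrow \<alpha>) \<otimes>\<^bsub>L\<^esub> u = gen (Arrow \<alpha>) \<otimes>\<^bsub>L\<^esub> (gen (Vertex (tail Q \<alpha>)) \<otimes>\<^bsub>L\<^esub> u)"
    using assms unfolding starts_at_def
    by (simp add: LA.mult_assoc[symmetric] gen_closed arrow_tail)
  then show ?thesis
    using vertex_mult[OF assms(1)] assms by (simp add: LA.mult_zero_right gen_closed)
qed

lemma arrow_star_mult:
  assumes "starts_at (head Q \<beta>) u" "\<alpha> \<in> arcs Q" "\<beta> \<in> arcs Q"
  shows "gen (Arrow \<alpha>) \<otimes>\<^bsub>L\<^esub> (gen (Star \<beta>) \<otimes>\<^bsub>L\<^esub> u) = (if \<alpha> = \<beta> then u else \<zero>\<^bsub>L\<^esub>)"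
  using assms unfolding starts_at_def
  by (auto simp: LA.mult_assoc[symmetric] gen_closed arrow_star LA.mult_zero_left)

lemma starts_at_arrow_path:
  assumes "run x p z" "x \<in> X" "starts_at (\<sigma> x) u"
  shows "starts_at (\<sigma> z) (arrow_path p u)"
  using assms
proof (induction p arbitrary: x u)
  case Nil
  then show ?case by simp
next
  case (Cons \<alpha> p)
  then have "\<alpha> \<in> arcs Q" "rest x \<in> X" "\<sigma> (rest x) = head Q \<alpha>"
    using fst_arc_Some[of x \<alpha>] by auto
  then show ?case
    using Cons starts_at_arrow[of \<alpha> u] by (auto simp: starts_at_def)
qed

lemma starts_at_star_path:
  assumes "run y q z" "y \<in> X" "starts_at (\<sigma> z) u"
  shows "starts_at (\<sigma> y) (star_path q u)"
  using assms
proof (induction q arbitrary: y)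
  case Nil
  then show ?case by simp
next
  case (Cons \<alpha> q)
  then have y: "\<alpha> \<in> arcs Q" "rest y \<in> X" "\<sigma> y = tail Q \<alpha>"
    using fst_arc_Some[of y \<alpha>] by auto
  then show ?case
    using Cons starts_at_star[of \<alpha> "star_path q u"] by (auto simp: starts_at_def)
qed

end

section \<open>The element of \<open>L e_i\<close> attached to each path that shares a tail with the
  base path\<close>

locale line_point_path = path_space k Q X \<sigma> fst_arc rest cons T
  for k :: "('k, 'r) ring_scheme" (structure) and Q :: "('v, 'a) pre_digraph"
    and X :: "'x set" and \<sigma> fst_arc rest cons T +
  fixes x0 :: 'x
  assumes x0: "x0 \<in> X" and line_point: "line_point Q (\<sigma> x0)"
begin

abbreviation "e0 \<equiv> gen (Vertex (\<sigma> x0))"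

text \<open>\<open>x0\<close> will be the tail of \<open>i\<close>, or the path from
  \<open>i\<close> to its end; this set then becomes \<open>tail_class\<close>, or the set of all
  paths to that end.\<close>

definition tail_class_x0 :: "'x set"
  where "tail_class_x0 = {y \<in> X. \<exists>p q z. run x0 p z \<and> run y q z}"

lemma run_linear: "run x0 p z \<Longrightarrow> linear_vertex Q (\<sigma> z)"
  using line_point run_awalk[OF _ x0] unfolding line_point_def by blast

text \<open>A nonempty run from \<open>z\<close> back to itself is an oriented cycle through a
  vertex reachable from the line point.\<close>

lemma run_cycle:
  assumes "run x0 p z" "run z s z"
  shows "s = []"
proof (rule ccontr)
  assume "s \<noteq> []"
  moreover have "awalk (\<sigma> z) s (\<sigma> z)"
    using run_awalk[OF assms(2)] run_awalk[OF assms(1) x0] by blast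
  ultimately show False
    using run_linear[OF assms(1)] hd_in_awalk_verts(1) unfolding linear_vertex_def by blast
qed

lemma starts_at_run: "run x0 p z \<Longrightarrow> starts_at (\<sigma> z) (arrow_path p e0)"
  using starts_at_arrow_path[OF _ x0] starts_at_vertex[OF start_vert[OF x0]] by blast

text \<open>The innermost pair in \<open>r^* r\<close> is that of the last arrow. It cancels because
  the source of that arrow is linear, and cancellation proceeds outwards.\<close>

lemma star_path_arrow_path:
  assumes "run x0 p z" "run z r z'"
  shows "star_path r (arrow_path r (arrow_path p e0)) = arrow_path p e0"
  using assms
proof (induction r arbitrary: p z)
  case Nil
  then show ?case by simp
next
  case (Cons \<alpha> r)
  have z: "fst_arc z = Some \<alpha>" "z \<in> X" using Cons.prems run_awalk[OF _ x0] by auto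
  note \<alpha> = fst_arc_Some[OF z(2,1)]
  \<comment> \<open>The first arrow of the list moves to the end of \<open>p\<close>; this is why
    \<open>p\<close> and \<open>z\<close> vary in the induction.\<close>
  have "run x0 (p @ [\<alpha>]) (rest z)" using Cons.prems by (auto simp: run_append)
  from Cons.IH[OF this] Cons.prems
  have IH: "star_path r (arrow_path r (gen (Arrow \<alpha>) \<otimes>\<^bsub>L\<^esub> arrow_path p e0)) = gen (Arrow \<alpha>) \<otimes>\<^bsub>L\<^esub> arrow_path p e0"
    by simp
  have s: "starts_at (tail Q \<alpha>) (arrow_path p e0)"
    using starts_at_run[OF Cons.prems(1)] \<alpha> by simp
  have "out_arcs Q (tail Q \<alpha>) = {\<alpha>}"
    using run_linear[OF Cons.prems(1)] \<alpha> unfolding linear_vertex_def by auto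
  then have "gen (Star \<alpha>) \<otimes>\<^bsub>L\<^esub> (gen (Arrow \<alpha>) \<otimes>\<^bsub>L\<^esub> arrow_path p e0) = arrow_path p e0"
    using s \<alpha> unfolding starts_at_def by (simp add: LA.mult_assoc[symmetric] gen_closed star_arrow)
  then show ?case using IH by simp
qed

lemma path_element_unique:
  assumes "run x0 p z" "run y q z" "run x0 p' z'" "run y q' z'" "length p \<le> length p'"
  shows "star_path q (arrow_path p e0) = star_path q' (arrow_path p' e0)"
proof -
  obtain r where r: "p' = p @ r" "run z r z'" using run_extend assms(1,3,5) by blast
  have qr: "run y (q @ r) z'" using assms(2) r by (auto simp: run_append)
  \<comment> \<open>Both lists lead from \<open>y\<close> to \<open>z'\<close>. One is a prefix of
    the other, and the surplus runs from \<open>z'\<close> to itself, hence is empty.\<close>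
  have "q' = q @ r"
  proof (cases "length q' \<le> length (q @ r)")
    case True
    then obtain s where s: "q @ r = q' @ s" "run z' s z'" using run_extend[OF assms(4) qr] by blast
    then show ?thesis using run_cycle[OF assms(3)] by simp
  next
    case False
    then obtain s where s: "q' = (q @ r) @ s" "run z' s z'" using run_extend[OF qr assms(4)] by auto
    then show ?thesis using run_cycle[OF assms(3)] by simp
  qed
  then show ?thesis using star_path_arrow_path[OF assms(1) r(2)] r(1) by simp
qed

text \<open>The value of \<psi> at the basis vector \<open>y\<close>. The lists \<open>p\<close> and
  \<open>q\<close> are not determined by \<open>y\<close>, hence the choice operator;
  \<open>path_element_eq\<close> eliminates it.\<close>

definition path_element :: "'x \<Rightarrow> (('v, 'a) lpa_gen list \<Rightarrow> 'k) set"
  where "path_element y =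
    (SOME u. \<exists>p q z. run x0 p z \<and> run y q z \<and> u = star_path q (arrow_path p e0))"

lemma path_element_eq:
  assumes "run x0 p z" "run y q z"
  shows "path_element y = star_path q (arrow_path p e0)"
  unfolding path_element_def
proof (rule someI2)
  show "\<exists>p' q' z. run x0 p' z \<and> run y q' z \<and> star_path q (arrow_path p e0) = star_path q' (arrow_path p' e0)"
    using assms by blast
  fix u assume "\<exists>p q z. run x0 p z \<and> run y q z \<and> u = star_path q (arrow_path p e0)"
  then show "u = star_path q (arrow_path p e0)"
    using path_element_unique[OF assms] path_element_unique[OF _ _ assms] nat_le_linear by metis
qed

lemma path_element_x0: "path_element x0 = e0"
  using path_element_eq[of "[]" x0 x0 "[]"] by simp

lemma starts_at_path_element:
  assumes "y \<in> tail_class_x0"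
  shows "starts_at (\<sigma> y) (path_element y)"
proof -
  obtain p q z where "run x0 p z" "run y q z" "y \<in> X"
    using assms unfolding tail_class_x0_def by blast
  then show ?thesis using path_element_eq starts_at_star_path starts_at_run by metis
qed

text \<open>If \<open>q\<close> is empty, \<alpha> is appended to \<open>p\<close>. Otherwise
  \<alpha> is the first arrow of \<open>q\<close>, and relation (3) cancels it against its
  star.\<close>

lemma rest_path_element:
  assumes y: "y \<in> tail_class_x0" and a: "fst_arc y = Some \<alpha>"
  shows "rest y \<in> tail_class_x0" "path_element (rest y) = gen (Arrow \<alpha>) \<otimes>\<^bsub>L\<^esub> path_element y"
proof -
  obtain p q z where pqz: "run x0 p z" "run y q z" and yX: "y \<in> X"
    using y unfolding tail_class_x0_def by blast
  note \<alpha> = fst_arc_Some[OF yX a]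
  have "rest y \<in> tail_class_x0 \<and> path_element (rest y) = gen (Arrow \<alpha>) \<otimes>\<^bsub>L\<^esub> path_element y"
  proof (cases q)
    case Nil
    then have "run x0 (p @ [\<alpha>]) (rest y)" "run (rest y) [] (rest y)"
      using pqz a by (auto simp: run_append)
    moreover from path_element_eq[OF this]
    have "path_element (rest y) = gen (Arrow \<alpha>) \<otimes>\<^bsub>L\<^esub> path_element y"
      using path_element_eq[OF pqz] Nil by simp
    ultimately show ?thesis using \<alpha> unfolding tail_class_x0_def by blast
  next
    case (Cons \<beta> q')
    then have q': "\<beta> = \<alpha>" "run (rest y) q' z" using pqz(2) a by auto
    have "starts_at (head Q \<alpha>) (star_path q' (arrow_path p e0))"
      using starts_at_star_path[OF q'(2)] starts_at_run[OF pqz(1)] \<alpha> by metis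
    then have "path_element (rest y) = gen (Arrow \<alpha>) \<otimes>\<^bsub>L\<^esub> path_element y"
      using path_element_eq[OF pqz] path_element_eq[OF pqz(1) q'(2)] arrow_star_mult \<alpha> Cons q' by simp
    then show ?thesis using \<alpha> pqz(1) q'(2) unfolding tail_class_x0_def by blast
  qed
  then show "rest y \<in> tail_class_x0" "path_element (rest y) = gen (Arrow \<alpha>) \<otimes>\<^bsub>L\<^esub> path_element y"
    by blast+
qed

text \<open>If \<open>q\<close> is empty, \<open>y\<close> is what remains of \<open>x0\<close>, so
  its start is linear and no arrow but the first arrow of \<open>y\<close> can leave it; thus
  \<alpha> starts elsewhere. Otherwise \<alpha> meets the star of a different arrow, and relation
  (3) gives zero.\<close>

lemma arrow_path_element_zero:
  assumes y: "y \<in> tail_class_x0" and \<alpha>: "\<alpha> \<in> arcs Q" and ne: "fst_arc y \<noteq> Some \<alpha>"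
  shows "gen (Arrow \<alpha>) \<otimes>\<^bsub>L\<^esub> path_element y = \<zero>\<^bsub>L\<^esub>"
proof -
  obtain p q z where pqz: "run x0 p z" "run y q z" and yX: "y \<in> X"
    using y unfolding tail_class_x0_def by blast
  show ?thesis
  proof (cases q)
    case Nil
    have "tail Q \<alpha> \<noteq> \<sigma> y"
    proof
      assume t: "tail Q \<alpha> = \<sigma> y"
      then obtain \<beta> where \<beta>: "fst_arc y = Some \<beta>"
        using fst_arc_None[OF yX] \<alpha> by (cases "fst_arc y") auto
      with t fst_arc_Some[OF yX \<beta>] \<alpha> run_linear[OF pqz(1)] pqz(2) Nil have "\<alpha> = \<beta>"
        unfolding linear_vertex_def by auto
      with ne \<beta> show False by simp
    qed
    then show ?thesis using arrow_mult_zero[OF starts_at_path_element[OF y] \<alpha>] by blast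
  next
    case (Cons \<beta> q')
    then have q': "fst_arc y = Some \<beta>" "run (rest y) q' z" using pqz(2) by auto
    note \<beta> = fst_arc_Some[OF yX q'(1)]
    have "starts_at (head Q \<beta>) (star_path q' (arrow_path p e0))"
      using starts_at_star_path[OF q'(2)] starts_at_run[OF pqz(1)] \<beta> by metis
    then show ?thesis
      using path_element_eq[OF pqz] arrow_star_mult[OF _ \<alpha>] \<beta> Cons q' ne by auto
  qed
qed

lemma cons_path_element:
  assumes y: "y \<in> tail_class_x0" and \<alpha>: "\<alpha> \<in> arcs Q" "head Q \<alpha> = \<sigma> y"
  shows "cons \<alpha> y \<in> tail_class_x0" "path_element (cons \<alpha> y) = gen (Star \<alpha>) \<otimes>\<^bsub>L\<^esub> path_element y"
proof -
  obtain p q z where pqz: "run x0 p z" "run y q z" and yX: "y \<in> X"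
    using y unfolding tail_class_x0_def by blast
  note c = cons[OF yX \<alpha>]
  have r: "run (cons \<alpha> y) (\<alpha> # q) z" using c pqz(2) by simp
  show "cons \<alpha> y \<in> tail_class_x0" using c r pqz(1) unfolding tail_class_x0_def by blast
  show "path_element (cons \<alpha> y) = gen (Star \<alpha>) \<otimes>\<^bsub>L\<^esub> path_element y"
    unfolding path_element_eq[OF pqz(1) r] path_element_eq[OF pqz] by simp
qed

lemma path_element_closed: "y \<in> tail_class_x0 \<Longrightarrow> path_element y \<in> carrier L"
  using starts_at_path_element unfolding starts_at_def by blast

abbreviation "FY \<equiv> free_module k tail_class_x0"
abbreviation "\<psi> \<equiv> lin_ext k L path_element"

lemma tail_class_subset: "tail_class_x0 \<subseteq> X"
  unfolding tail_class_x0_def by blast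

lemma x0_tail_class: "x0 \<in> tail_class_x0"
  unfolding tail_class_x0_def using x0 run.simps(1) by blast

lemma \<psi>_linear: "\<psi> \<in> linear_maps k FY L"
  by (rule LA.lin_ext_linear) (rule path_element_closed)

lemma \<psi>_basis: "y \<in> tail_class_x0 \<Longrightarrow> \<psi> (basis_vec k y) = path_element y"
  by (rule LA.lin_ext_basis) (rule path_element_closed)

lemma \<psi>_zero: "\<psi> (\<lambda>_. \<zero>) = \<zero>\<^bsub>L\<^esub>"
  using linear_maps_zero[OF \<psi>_linear module_free_module LA.module_axioms] by simp

text \<open>The preceding lemmas cover the cases in which \<open>T g y\<close> is a path; where it
  is zero, the product in \<open>L\<close> vanishes too.\<close>

lemma \<psi>_T:
  assumes "g \<in> lpa_gens Q" "y \<in> tail_class_x0"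
  shows "T g y \<in> carrier FY \<and> \<psi> (T g y) = gen g \<otimes>\<^bsub>L\<^esub> path_element y"
proof (cases g)
  case (Vertex i)
  then show ?thesis
    using assms vertex_mult[OF starts_at_path_element[OF assms(2)], of i]
    by (auto simp: T_Vertex \<psi>_basis \<psi>_zero basis_vec_carrier zero_free_module)
next
  case (Arrow \<alpha>)
  then show ?thesis
    using assms rest_path_element[OF assms(2), of \<alpha>] arrow_path_element_zero[OF assms(2), of \<alpha>]
    by (auto simp: T_Arrow \<psi>_basis \<psi>_zero basis_vec_carrier zero_free_module)
next
  case (Star \<alpha>)
  then show ?thesis
    using assms cons_path_element[OF assms(2), of \<alpha>]
      star_mult_zero[OF starts_at_path_element[OF assms(2)], of \<alpha>]
    by (auto simp: T_Star \<psi>_basis \<psi>_zero basis_vec_carrier zero_free_module)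
qed

sublocale GR: alg_representation k L GR
  by (rule leavitt_representation)

lemma FY_GR: "f \<in> carrier FY \<Longrightarrow> f \<in> carrier GR"
  using free_module_mono[OF tail_class_subset] by auto

lemma FY_submodule: "submodule (carrier FY) k GR"
  by (rule submodule_free_module[OF GR.M.module_axioms tail_class_subset]) simp_all

text \<open>Invariance of the span and equivariance share one induction: for a product
  \<open>x y\<close> the claim for \<open>x\<close> is applied to \<open>y.f\<close>, which must lie
  in the span again. For the same reason \<open>f\<close> varies.\<close>

lemma act_\<psi>:
  assumes "x \<in> carrier L" "f \<in> carrier FY"
  shows "act GR x f \<in> carrier FY \<and> \<psi> (act GR x f) = x \<otimes>\<^bsub>L\<^esub> \<psi> f"
  using assms
proof (induction arbitrary: f rule: leavitt_induct)
  case zero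
  note GR.act_zero[OF FY_GR[OF zero]]
  then show ?case
    using linear_maps_closed[OF \<psi>_linear zero] by (simp add: \<psi>_zero zero_free_module LA.mult_zero_left)
next
  case (gen g)
  note lin = linear_mapsD[OF GR.act_linear[OF gen_closed[OF gen(1)]]]
  note P = linear_mapsD[OF \<psi>_linear]
  note sub = GR.M.submodule_mem[OF FY_submodule]
  \<comment> \<open>For a generator an inner induction on \<open>f\<close> leads to basis vectors,
    where \<open>\<psi>_T\<close> applies.\<close>
  show ?case
    using gen(2)
  proof (induction rule: free_module_induct)
    case zero
    have "act GR (gen g) \<zero>\<^bsub>GR\<^esub> = \<zero>\<^bsub>GR\<^esub>"
      by (rule linear_maps_zero[OF GR.act_linear[OF gen_closed[OF gen(1)]] GR.M.module_axioms GR.M.module_axioms])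
    then show ?case
      using gen_closed[OF gen(1)] by (simp add: \<psi>_zero zero_free_module LA.mult_zero_right)
  next
    case (basis y)
    then show ?case
      using act_gen[OF gen(1)] \<psi>_T[OF gen(1)] tail_class_subset by (auto simp: \<psi>_basis)
  next
    case (smult c f)
    then show ?case
      using lin(3)[OF smult(1) FY_GR[OF smult(2)]] sub(3)[OF smult(1), of "act GR (gen g) f"]
        P(3)[OF smult(1) smult(2)] P(3)[OF smult(1), of "act GR (gen g) f"]
        LA.smult_mult_right[OF smult(1) gen_closed[OF gen(1)] P(1)[OF smult(2)]] by simp
  next
    case (add f f')
    then show ?case
      using lin(2)[OF FY_GR[OF add(1)] FY_GR[OF add(2)]]
        sub(2)[of "act GR (gen g) f" "act GR (gen g) f'"]
        P(2)[OF add(1,2)] P(2)[of "act GR (gen g) f" "act GR (gen g) f'"]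
        LA.mult_r_distr[OF gen_closed[OF gen(1)] P(1)[OF add(1)] P(1)[OF add(2)]] by simp
  qed
next
  case (add x y)
  note f = add(5)
  have "act GR (x \<oplus>\<^bsub>L\<^esub> y) f = act GR x f \<oplus>\<^bsub>FY\<^esub> act GR y f"
    using GR.act_add[OF add(1,2) FY_GR[OF f]] by simp
  moreover have "act GR x f \<oplus>\<^bsub>FY\<^esub> act GR y f \<in> carrier FY"
    using GR.M.submodule_add[OF FY_submodule] add(3,4)[OF f] by simp
  moreover have "\<psi> (act GR x f \<oplus>\<^bsub>FY\<^esub> act GR y f) = (x \<oplus>\<^bsub>L\<^esub> y) \<otimes>\<^bsub>L\<^esub> \<psi> f"
    using linear_maps_add[OF \<psi>_linear] add(3,4)[OF f]
      LA.mult_l_distr[OF add(1,2) linear_maps_closed[OF \<psi>_linear f]] by simp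
  ultimately show ?case by simp
next
  case (smult c x)
  note f = smult(4)
  have "act GR (c \<odot>\<^bsub>L\<^esub> x) f = c \<odot>\<^bsub>FY\<^esub> act GR x f"
    using GR.act_smult[OF smult(1,2) FY_GR[OF f]] by simp
  moreover have "c \<odot>\<^bsub>FY\<^esub> act GR x f \<in> carrier FY"
    using GR.M.submodule_smult[OF FY_submodule smult(1)] smult(3)[OF f] by simp
  moreover have "\<psi> (c \<odot>\<^bsub>FY\<^esub> act GR x f) = (c \<odot>\<^bsub>L\<^esub> x) \<otimes>\<^bsub>L\<^esub> \<psi> f"
    using linear_maps_smult[OF \<psi>_linear smult(1)] smult(3)[OF f]
      LA.smult_mult_left[OF smult(1,2) linear_maps_closed[OF \<psi>_linear f]] by simp
  ultimately show ?case by simp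
next
  case (mult x y)
  note f = mult(5)
  show ?case
    using GR.act_mult[OF mult(1,2) FY_GR[OF f]] mult(4)[OF f] mult(3)[of "act GR y f"]
      LA.mult_assoc[OF mult(1,2) linear_maps_closed[OF \<psi>_linear f]] by simp
qed

section \<open>Surjectivity: the orbit of the base vector under \<open>L\<close>\<close>

definition orbit :: "('x \<Rightarrow> 'k) set"
  where "orbit = (\<lambda>x. act GR x (basis_vec k x0)) ` carrier L"

lemma orbit_act:
  assumes "x \<in> carrier L" "n \<in> orbit"
  shows "act GR x n \<in> orbit"
proof -
  obtain y where "y \<in> carrier L" "n = act GR y (basis_vec k x0)"
    using assms(2) unfolding orbit_def by blast
  then have "act GR x n = act GR (x \<otimes>\<^bsub>L\<^esub> y) (basis_vec k x0)" "x \<otimes>\<^bsub>L\<^esub> y \<in> carrier L"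
    using GR.act_mult[OF assms(1)] LA.mult_closed[OF assms(1)] x0 by (simp_all add: basis_vec_carrier)
  then show ?thesis unfolding orbit_def by blast
qed

lemma orbit_x0: "basis_vec k x0 \<in> orbit"
proof -
  have "act GR e0 (basis_vec k x0) = basis_vec k x0"
    using act_gen[of "Vertex (\<sigma> x0)" x0] x0 start_vert by (simp add: T_Vertex)
  then show ?thesis unfolding orbit_def using gen_closed[of "Vertex (\<sigma> x0)"] start_vert[OF x0]
    by (metis image_eqI lpa_gens_iff(1))
qed

lemma orbit_rest:
  assumes "y \<in> X" "fst_arc y = Some \<alpha>" "basis_vec k y \<in> orbit"
  shows "basis_vec k (rest y) \<in> orbit"
proof -
  have \<alpha>: "Arrow \<alpha> \<in> lpa_gens Q" using fst_arc_Some assms by simp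
  show ?thesis
    using orbit_act[OF gen_closed[OF \<alpha>] assms(3)] act_gen[OF \<alpha> assms(1)] assms(2)
    by (simp add: T_Arrow)
qed

lemma orbit_cons:
  assumes "y \<in> X" "fst_arc y = Some \<alpha>" "basis_vec k (rest y) \<in> orbit"
  shows "basis_vec k y \<in> orbit"
proof -
  note y = fst_arc_Some[OF assms(1,2)]
  have \<alpha>: "Star \<alpha> \<in> lpa_gens Q" using y by simp
  have "act GR (gen (Star \<alpha>)) (basis_vec k (rest y)) = basis_vec k y"
    using act_gen[OF \<alpha>, of "rest y"] y by (simp add: T_Star)
  then show ?thesis using orbit_act[OF gen_closed[OF \<alpha>] assms(3)] by simp
qed

text \<open>Removing an arrow is undone by acting with its star, so membership passes both ways:
  from \<open>x0\<close> down to the common tail and from there up to \<open>y\<close>.\<close>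

lemma orbit_run: "\<lbrakk>run y q z; y \<in> X\<rbrakk> \<Longrightarrow> basis_vec k y \<in> orbit \<longleftrightarrow> basis_vec k z \<in> orbit"
proof (induction q arbitrary: y)
  case Nil
  then show ?case by simp
next
  case (Cons \<alpha> q)
  then have y: "fst_arc y = Some \<alpha>" "run (rest y) q z" by auto
  then show ?case
    using Cons.IH[OF y(2)] fst_arc_Some[OF Cons.prems(2) y(1)]
      orbit_rest[OF Cons.prems(2) y(1)] orbit_cons[OF Cons.prems(2) y(1)] by blast
qed

lemma FY_orbit:
  assumes "f \<in> carrier FY"
  shows "f \<in> orbit"
proof -
  have v: "basis_vec k x0 \<in> carrier GR" using x0 by (simp add: basis_vec_carrier)
  show ?thesis
    using assms
  proof (induction rule: free_module_induct)
    case zero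
    note GR.act_zero[OF v]
    then show ?case unfolding orbit_def using LA.M.zero_closed by force
  next
    case (basis y)
    then show ?case
      unfolding tail_class_x0_def using orbit_run[OF _ x0] orbit_run orbit_x0 by blast
  next
    case (smult c f)
    then obtain x where "x \<in> carrier L" "f = act GR x (basis_vec k x0)" unfolding orbit_def by blast
    then show ?case
      using GR.act_smult[OF smult(1) _ v, of x] LA.smult_closed[OF smult(1), of x]
      unfolding orbit_def by force
  next
    case (add f f')
    then obtain x x' where "x \<in> carrier L" "f = act GR x (basis_vec k x0)"
      "x' \<in> carrier L" "f' = act GR x' (basis_vec k x0)" unfolding orbit_def by blast
    then have "(\<lambda>a. f a \<oplus> f' a) = act GR (x \<oplus>\<^bsub>L\<^esub> x') (basis_vec k x0)" "x \<oplus>\<^bsub>L\<^esub> x' \<in> carrier L"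
      using GR.act_add[OF _ _ v] by simp_all
    then show ?case unfolding orbit_def by blast
  qed
qed

text \<open>The common form of both parts of the theorem; each instance only has to identify
  \<open>tail_class_x0\<close>.\<close>

lemma rep_isomorphic_tail_class:
  "rep_isomorphic k L (left_ideal_rep L e0)
    (GR\<lparr>carrier := spanned k GR (basis_vec k ` tail_class_x0)\<rparr>)"
proof -
  have span: "spanned k GR (basis_vec k ` tail_class_x0) = carrier FY"
    by (rule spanned_basis_vec[OF GR.M.module_axioms tail_class_subset]) simp_all
  have e0: "Vertex (\<sigma> x0) \<in> lpa_gens Q" using start_vert[OF x0] by simp
  show ?thesis
    unfolding span
  proof (rule rep_isomorphic_left_ideal[where v = "basis_vec k x0" and \<psi> = \<psi>])
    show "alg_representation k L (GR\<lparr>carrier := carrier FY\<rparr>)"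
      by (rule alg_representation_subrep[OF GR.alg_representation_axioms FY_submodule])
        (use act_\<psi> in blast)
    show "e0 \<in> carrier L" by (rule gen_closed[OF e0])
    show "e0 \<otimes>\<^bsub>L\<^esub> e0 = e0" using vertex_vertex start_vert[OF x0] by simp
    show "basis_vec k x0 \<in> carrier (GR\<lparr>carrier := carrier FY\<rparr>)"
      using x0_tail_class by (simp add: basis_vec_carrier)
    show "act (GR\<lparr>carrier := carrier FY\<rparr>) e0 (basis_vec k x0) = basis_vec k x0"
      using act_gen[OF e0 x0] by (simp add: T_Vertex)
    show "\<psi> (basis_vec k x0) = e0"
      by (simp add: \<psi>_basis[OF x0_tail_class] path_element_x0)
    show "\<exists>x\<in>carrier L. act (GR\<lparr>carrier := carrier FY\<rparr>) x (basis_vec k x0) = n"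
      if "n \<in> carrier (GR\<lparr>carrier := carrier FY\<rparr>)" for n
      using FY_orbit[of n] that unfolding orbit_def by auto
    show "\<psi> (act (GR\<lparr>carrier := carrier FY\<rparr>) x n) = x \<otimes>\<^bsub>L\<^esub> \<psi> n"
      if "x \<in> carrier L" "n \<in> carrier (GR\<lparr>carrier := carrier FY\<rparr>)" for x n
      using act_\<psi>[of x n] that by simp
  qed
qed

end

section \<open>The two families of representations\<close>

lemma tau_gt_simps:
  "tau_gt 0 p = p"
  "tau_gt m (tau_gt n p) = tau_gt (n + m) p"
  "tau_gt n p m = p (n + m)"
  by (simp_all add: tau_gt_def add.assoc)

text \<open>An infinite path always has a first arrow, hence the constant \<open>Some\<close>.
  \<open>Suc 0\<close> is the simp normal form of the \<open>1\<close> in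
  \<open>F_gen\<close>.\<close>

lemma path_space_F:
  assumes "cring k" "wf_digraph Q"
  shows "path_space k Q (left_infinite_paths Q) (inf_start Q) (\<lambda>p. Some (p 0)) (tau_gt (Suc 0)) case_nat (F_gen k Q)"
proof -
  interpret leavitt_algebra k Q by (intro leavitt_algebra.intro assms)
  show ?thesis
  proof unfold_locales
    fix p \<alpha> assume p: "p \<in> left_infinite_paths Q"
    then have "p 0 \<in> arcs Q" by (simp add: left_infinite_paths_def)
    then show "inf_start Q p \<in> verts Q" by (simp add: inf_start_def)
    have "case_nat (p 0) (tau_gt (Suc 0) p) = p"
      by (auto simp: fun_eq_iff tau_gt_def split: nat.split)
    then show "\<alpha> \<in> arcs Q \<and> tail Q \<alpha> = inf_start Q p \<and> tau_gt (Suc 0) p \<in> left_infinite_paths Q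
        \<and> inf_start Q (tau_gt (Suc 0) p) = head Q \<alpha> \<and> case_nat \<alpha> (tau_gt (Suc 0) p) = p"
      if "Some (p 0) = Some \<alpha>"
      using p that by (auto simp: left_infinite_paths_def inf_start_def tau_gt_def)
    show "case_nat \<alpha> p \<in> left_infinite_paths Q \<and> inf_start Q (case_nat \<alpha> p) = tail Q \<alpha>
        \<and> Some (case_nat \<alpha> p 0) = Some \<alpha> \<and> tau_gt (Suc 0) (case_nat \<alpha> p) = p"
      if "\<alpha> \<in> arcs Q" "head Q \<alpha> = inf_start Q p"
      using p that
      by (auto simp: left_infinite_paths_def inf_start_def tau_gt_def fun_eq_iff split: nat.split)
  qed auto
qed

lemma rep_isomorphic_F:
  assumes "cring k" "wf_digraph Q" "line_point Q i" "is_tail_of Q i p"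
  shows "rep_isomorphic k (leavitt k Q)
    (left_ideal_rep (leavitt k Q) (leavitt_gen k Q (Vertex i))) (F_class_rep k Q p)"
proof -
  have p: "p \<in> left_infinite_paths Q" "inf_start Q p = i"
    using assms(4) by (auto simp: is_tail_of_def)
  interpret line_point_path k Q "left_infinite_paths Q" "inf_start Q" "\<lambda>p. Some (p 0)" "tau_gt (Suc 0)" case_nat
    "F_gen k Q" p
    by (intro line_point_path.intro path_space_F assms line_point_path_axioms.intro)
      (use p assms in auto)
  have tau: "run q (map q [0..<n]) (tau_gt n q)" for q n
  proof (induction n)
    case (Suc n)
    have "run (tau_gt n q) [q n] (tau_gt (Suc n) q)"
      by (simp add: tau_gt_simps)
    with Suc show ?case by (auto simp: run_append)
  qed (simp add: tau_gt_simps(1))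
  \<comment> \<open>Conversely, what a run on an infinite path leaves depends only on its length, so
    sharing a tail in the sense of \<open>run\<close> is tail-equivalence.\<close>
  have run: "z = tau_gt (length l) q" if "run q l z" for q l z
    using that
  proof (induction l arbitrary: q)
    case (Cons \<alpha> l)
    then have "z = tau_gt (length l) (tau_gt (Suc 0) q)" by simp
    then show ?case by (simp add: tau_gt_simps(2))
  qed (simp add: tau_gt_simps(1))
  have "tail_class Q p = tail_class_x0"
  proof (intro equalityI subsetI)
    fix q assume "q \<in> tail_class Q p"
    then obtain n m where q: "q \<in> left_infinite_paths Q" "tau_gt n p = tau_gt m q"
      unfolding tail_class_def tail_equivalent_def by blast
    have "run q (map q [0..<m]) (tau_gt n p)" unfolding q(2) by (rule tau)
    then show "q \<in> tail_class_x0"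
      unfolding tail_class_x0_def using q(1) tau[of p n] by blast
  next
    fix q assume "q \<in> tail_class_x0"
    then obtain l r z where q: "q \<in> left_infinite_paths Q" and "run p l z" "run q r z"
      unfolding tail_class_x0_def by blast
    then have "tau_gt (length l) p = tau_gt (length r) q" using run by metis
    then show "q \<in> tail_class Q p"
      unfolding tail_class_def tail_equivalent_def using q by blast
  qed
  then show ?thesis
    using rep_isomorphic_tail_class p by (simp add: F_class_rep_def F_rep_def)
qed

section \<open>Finite paths ending at a sink\<close>

abbreviation first_arrow :: "'v \<times> 'a list \<Rightarrow> 'a option"
  where "first_arrow x \<equiv> (case snd x of [] \<Rightarrow> None | \<alpha> # _ \<Rightarrow> Some \<alpha>)"

lemma path_space_N:
  assumes "cring k" "wf_digraph Q"
  shows "path_space k Q (\<Union>j \<in> {j. sink Q j}. paths_to Q j) fst first_arrow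
    (\<lambda>(j, p). (head Q (hd p), tl p)) (\<lambda>\<alpha> (j, p). (tail Q \<alpha>, \<alpha> # p)) (N_gen k Q)"
proof -
  interpret leavitt_algebra k Q by (intro leavitt_algebra.intro assms)
  show ?thesis
  proof (intro path_space.intro path_space_axioms.intro leavitt_algebra_axioms, goal_cases)
    case (1 x) then show ?case by (auto simp: paths_to_def awalk_def)
  next
    case (2 x) then show ?case by (auto simp: paths_to_def awalk_Nil_iff sink_def split: list.splits)
  next
    case (3 x \<alpha>) then show ?case by (auto simp: paths_to_def awalk_Cons_iff split: list.splits)
  next
    case (4 x \<alpha>) then show ?case by (auto simp: paths_to_def awalk_Cons_iff)
  next
    case (5 i x) then show ?case by (cases x) simp
  next
    case (6 \<alpha> x) then show ?case by (cases x) (auto split: list.split)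
  next
    case (7 \<alpha> x) then show ?case by (cases x) simp
  qed
qed

lemma rep_isomorphic_N:
  assumes "cring k" "wf_digraph Q" "line_point Q i" "is_end_of Q i i0"
  shows "rep_isomorphic k (leavitt k Q)
    (left_ideal_rep (leavitt k Q) (leavitt_gen k Q (Vertex i))) (N_sink_rep k Q i0)"
proof -
  obtain p where i0: "sink Q i0" and p: "pre_digraph.awalk Q i p i0"
    using assms(4) unfolding is_end_of_def by blast
  let ?X = "\<Union>j \<in> {j. sink Q j}. paths_to Q j"
  have x0: "(i, p) \<in> ?X" using i0 p by (auto simp: paths_to_def)
  interpret line_point_path k Q ?X fst first_arrow
    "\<lambda>(j, p). (head Q (hd p), tl p)" "\<lambda>\<alpha> (j, p). (tail Q \<alpha>, \<alpha> # p)" "N_gen k Q" "(i, p)"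
    by (intro line_point_path.intro path_space_N assms line_point_path_axioms.intro)
      (use x0 assms in auto)
  \<comment> \<open>Every path to \<open>i0\<close> runs down to the trivial path there, which is
    therefore a common tail of any two such paths.\<close>
  have to_end: "run (j, l) l (i0, [])" if "awalk j l i0" for j l
    using that by (induction l arbitrary: j) (auto simp: awalk_Nil_iff awalk_Cons_iff)
  \<comment> \<open>Removing arrows does not move the end of a path; this keeps paths into other
    sinks out of the tail class.\<close>
  have same_end: "y \<in> paths_to Q i0 \<longleftrightarrow> z \<in> paths_to Q i0" if "run y q z" "y \<in> ?X" for y q z
    using that
  proof (induction q arbitrary: y)
    case Nil
    then show ?case by simp
  next
    case (Cons \<alpha> q)
    obtain j l where y: "y = (j, \<alpha> # l)"
      using Cons.prems(1) by (cases y) (auto split: list.splits)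
    then have step: "run (head Q \<alpha>, l) q z" using Cons.prems(1) by simp
    have \<alpha>: "\<alpha> \<in> arcs Q" "tail Q \<alpha> = j" "(head Q \<alpha>, l) \<in> ?X"
      using fst_arc_Some[OF Cons.prems(2), of \<alpha>] y by auto
    then have "y \<in> paths_to Q i0 \<longleftrightarrow> (head Q \<alpha>, l) \<in> paths_to Q i0"
      by (simp add: y paths_to_def awalk_Cons_iff)
    then show ?case using Cons.IH[OF step \<alpha>(3)] by simp
  qed
  have "paths_to Q i0 = tail_class_x0"
  proof (intro equalityI subsetI)
    fix y assume "y \<in> paths_to Q i0"
    then obtain j l where y: "y = (j, l)" "awalk j l i0" by (auto simp: paths_to_def)
    moreover have "y \<in> ?X" using i0 y by (auto simp: paths_to_def)
    ultimately show "y \<in> tail_class_x0"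
      unfolding tail_class_x0_def using to_end[OF p] to_end[OF y(2)] by blast
  next
    fix y assume "y \<in> tail_class_x0"
    then obtain q r z where "y \<in> ?X" "run (i, p) q z" "run y r z"
      unfolding tail_class_x0_def by blast
    moreover have "(i, p) \<in> paths_to Q i0" using p by (simp add: paths_to_def)
    ultimately show "y \<in> paths_to Q i0" using same_end x0 by blast
  qed
  then show ?thesis
    using rep_isomorphic_tail_class by (simp add: N_sink_rep_def N_rep_def)
qed

theorem proposition4p3:
  fixes k :: "('k, 'r) ring_scheme" and Q :: "('v, 'a) pre_digraph"
  assumes "field k" and "wf_digraph Q"
  shows "(\<forall>i p. infinite_line_point Q i \<and> is_tail_of Q i p \<longrightarrow>
            rep_isomorphic k (leavitt k Q)
              (left_ideal_rep (leavitt k Q) (leavitt_gen k Q (Vertex i))) (F_class_rep k Q p))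
       \<and> (\<forall>i i0. finite_line_point Q i \<and> is_end_of Q i i0 \<longrightarrow>
            rep_isomorphic k (leavitt k Q)
              (left_ideal_rep (leavitt k Q) (leavitt_gen k Q (Vertex i))) (N_sink_rep k Q i0))"
proof -
  have k: "cring k" using assms(1) by (simp add: field_def domain_def)
  show ?thesis
    unfolding infinite_line_point_def finite_line_point_def
    by (intro conjI allI impI; elim conjE; rule rep_isomorphic_F[OF k assms(2)] rep_isomorphic_N[OF k assms(2)])
qed

end
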